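(* For every $\delta, \epsilon > 0$ there are constants $C, c > 0$ such that the following holds. Let $p > C$ be a prime, let $A, B \in \mathfrak{sl}_2(\mathbf{F}_p)$ be independent and uniformly random, let $(X_k)_{k \ge 0}$ be the random Lie bracket associated with $A,B$, and for $k \ge 0$ let $\mu_{2k}$ be the distribution of $X_{2k}$ (conditionally on $A,B$). Then, with probability at least $1-\delta$ over the choice of $(A,B)$, the limiting distributions $\nu_{2k}$ associated with $A,B$ are defined, each $\nu_{2k}$ is uniform on a coset of a subgroup of $\mathbf{F}_p^\ast \cong \mathrm{Lin}\{[A,B]\} \setminus \{0\}$, and both of the following hold: 1. for all integers $k \ge 0$ with $k < cp$, we have $\mathrm{d}(\mu_{2k}, \nu_{2k}) > 1 - \epsilon$; 2. for all integers $k$ with $k > Cp$, we have $\mathrm{d}(\mu_{2k}, \nu_{2k}) < \epsilon$.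
   Context: Throughout $p$ is an odd prime. $\mathfrak{sl}_2(\mathbf{F}_p)$ is the Lie algebra of trace-zero $2\times 2$ matrices over $\mathbf{F}_p$ with $[X,Y]=XY-YX$. $\mathrm{Lin}\{v\}$ denotes the $\mathbf{F}_p$-line spanned by $v$; when $[A,B]\neq 0$, the set $\mathrm{Lin}\{[A,B]\}\setminus\{0\}$ is identified with the multiplicative group $\mathbf{F}_p^\ast$ via $c\,[A,B] \leftrightarrow c$. For probability measures $\mu,\nu$ on a finite set, $\mathrm{d}(\mu,\nu)=\frac12\|\mu-\nu\|_1 = \frac12\sum_x|\mu(x)-\nu(x)|$ is the total variation distance. Random Lie bracket associated with $A,B$: let $Z_1,Z_2,\dots$ be independent random variables, each equal to $A$ or to $B$ with probability $1/2$; put $X_0=[A,B]$ and $X_k=[Z_k,X_{k-1}]$ for $k\ge 1$. Limiting distribution $\nu_{2k}$: let $\alpha=2\,\mathrm{tr}(AB)$, $\beta=2\,\mathrm{tr}(A^2)$, $\gamma=2\,\mathrm{tr}(B^2)$. Suppose $\alpha\beta\gamma\ne 0$ and $[A,B]\neq 0$. Put $n=p-1$, fix a group isomorphism $\log:\mathbf{F}_p^\ast\to\mathbf{Z}_n=\mathbf{Z}/n\mathbf{Z}$, and let $\alpha'=\log\alpha$, $\beta'=\log\beta$, $\gamma'=\log\gamma$. For $j\in\mathbf{Z}_n$ let $\chi_j(x)=e^{2\pi i jx/n}$ and $\lambda_j=\frac12\chi_j(-\alpha')+\frac14\chi_j(-\beta')+\frac14\chi_j(-\gamma')$. Let $\phi_k=\frac1n\sum_{j:|\lambda_j|=1}\lambda_j^k\chi_j$,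 a function on $\mathbf{Z}_n$ (it is a probability distribution). Then $\nu_{2k}$ is the distribution on $\mathrm{Lin}\{[A,B]\}\setminus\{0\}$ with $\nu_{2k}(c\,[A,B])=\phi_k(\log c)$ for $c\in\mathbf{F}_p^\ast$, extended by zero. If $\alpha\beta\gamma=0$ or $[A,B]=0$, then $\nu_{2k}$ is not defined. *)

theory Defs
  imports "HOL-Analysis.Analysis" "HOL-Probability.Probability" "HOL-Probability.Product_PMF"
    "HOL-Algebra.Elementary_Groups" "HOL-Number_Theory.Residues"
begin

text \<open>
  The bound on \<open>p\<close> is existentially quantified in the theorem, so the prime field cannot be a type.
  It is the carrier \<open>{0..p - 1}\<close> of \<^const>\<open>residue_ring\<close>, and a \<open>2 \<times> 2\<close> matrix over it is
  an integer matrix with entries in that set; results of matrix operations are reduced entrywise.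
\<close>

type_synonym mat2 = "int ^ 2 ^ 2"

abbreviation Fp :: "nat \<Rightarrow> int ring" where
  "Fp p \<equiv> residue_ring (int p)"

abbreviation Fp_mult :: "nat \<Rightarrow> int monoid" where
  "Fp_mult p \<equiv> units_of (Fp p)"

definition mat_mod :: "nat \<Rightarrow> mat2 \<Rightarrow> mat2" where
  "mat_mod p M = (\<chi> i j. M $ i $ j mod int p)"

definition tr :: "nat \<Rightarrow> mat2 \<Rightarrow> int" where
  "tr p M = trace M mod int p"

definition scale :: "nat \<Rightarrow> int \<Rightarrow> mat2 \<Rightarrow> mat2" where
  "scale p c M = (\<chi> i j. c * M $ i $ j mod int p)"

definition sl2 :: "nat \<Rightarrow> mat2 set" where
  "sl2 p = {M. (\<forall>i j. M $ i $ j \<in> carrier (Fp p)) \<and> tr p M = 0}"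

definition bracket :: "nat \<Rightarrow> mat2 \<Rightarrow> mat2 \<Rightarrow> mat2" where
  "bracket p X Y = mat_mod p (X ** Y - Y ** X)"


text \<open>\<open>lie_walk p A B Z k\<close> is \<open>X\<^sub>k\<close>, as a function of the values \<open>Z 1, \<dots>, Z k\<close>.\<close>

primrec lie_walk :: "nat \<Rightarrow> mat2 \<Rightarrow> mat2 \<Rightarrow> (nat \<Rightarrow> mat2) \<Rightarrow> nat \<Rightarrow> mat2" where
  "lie_walk p A B Z 0 = bracket p A B"
| "lie_walk p A B Z (Suc k) = bracket p (Z (Suc k)) (lie_walk p A B Z k)"

definition step_pmf :: "mat2 \<Rightarrow> mat2 \<Rightarrow> mat2 pmf" where
  "step_pmf A B = map_pmf (\<lambda>b. if b then A else B) (bernoulli_pmf (1/2))"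

text \<open>
  The law of \<open>X\<^sub>k\<close> for given \<open>A\<close>, \<open>B\<close>. The second argument of \<^const>\<open>Pi_pmf\<close> is only the value of
  \<open>Z i\<close> for \<open>i \<notin> {1..k}\<close>, on which \<open>X\<^sub>k\<close> does not depend.
\<close>

definition lie_bracket_pmf :: "nat \<Rightarrow> mat2 \<Rightarrow> mat2 \<Rightarrow> nat \<Rightarrow> mat2 pmf" where
  "lie_bracket_pmf p A B k =
     map_pmf (\<lambda>Z. lie_walk p A B Z k) (Pi_pmf {1..k} 0 (\<lambda>_. step_pmf A B))"

definition tv_dist :: "'a pmf \<Rightarrow> 'a pmf \<Rightarrow> real" where
  "tv_dist \<mu> \<nu> = (\<Sum>\<^sub>\<infinity>x. \<bar>pmf \<mu> x - pmf \<nu> x\<bar>) / 2"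


definition chi :: "nat \<Rightarrow> int \<Rightarrow> int \<Rightarrow> complex" where
  "chi n j x = exp (2 * of_real pi * \<i> * of_int j * of_int x / of_nat n)"

definition lam :: "nat \<Rightarrow> int \<Rightarrow> int \<Rightarrow> int \<Rightarrow> int \<Rightarrow> complex" where
  "lam n a b c j = chi n j (- a) / 2 + chi n j (- b) / 4 + chi n j (- c) / 4"

definition phi :: "nat \<Rightarrow> int \<Rightarrow> int \<Rightarrow> int \<Rightarrow> nat \<Rightarrow> int \<Rightarrow> complex" where
  "phi n a b c k x =
     (\<Sum>j \<in> {j \<in> carrier (integer_mod_group n). cmod (lam n a b c j) = 1}.
        lam n a b c j ^ k * chi n j x) / of_nat n"

text \<open>
  \<open>limiting_dist p lg A B k \<nu>\<close> says that \<open>\<nu>\<^sub>2\<^sub>k\<close> is defined and equal to \<open>\<nu>\<close>, with \<open>lg\<close> in the role of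
  the isomorphism \<open>log\<close>. The last two conditions determine \<open>\<nu>\<close> at every point; as the first of them equates
  \<^const>\<open>phi\<close> with a \<^const>\<open>pmf\<close>, it includes that \<^const>\<open>phi\<close> is real and a probability distribution.
\<close>

definition limiting_dist ::
  "nat \<Rightarrow> (int \<Rightarrow> int) \<Rightarrow> mat2 \<Rightarrow> mat2 \<Rightarrow> nat \<Rightarrow> mat2 pmf \<Rightarrow> bool" where
  "limiting_dist p lg A B k \<nu> \<longleftrightarrow>
     (let \<alpha> = 2 * tr p (A ** B) mod int p;
          \<beta> = 2 * tr p (A ** A) mod int p;
          \<gamma> = 2 * tr p (B ** B) mod int p
      in \<alpha> * \<beta> * \<gamma> mod int p \<noteq> 0 \<and> bracket p A B \<noteq> 0 \<and>
         (\<forall>c \<in> carrier (Fp_mult p). complex_of_real (pmf \<nu> (scale p c (bracket p A B)))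
            = phi (p - 1) (lg \<alpha>) (lg \<beta>) (lg \<gamma>) k (lg c)) \<and>
         (\<forall>X. X \<notin> (\<lambda>c. scale p c (bracket p A B)) ` carrier (Fp_mult p) \<longrightarrow> pmf \<nu> X = 0))"

text \<open>Uniform on a coset of a subgroup of the multiplicative group, transported by \<open>c \<mapsto> c V\<close>.\<close>

definition uniform_on_coset :: "nat \<Rightarrow> mat2 \<Rightarrow> mat2 pmf \<Rightarrow> bool" where
  "uniform_on_coset p V \<nu> \<longleftrightarrow>
     (\<exists>H K. subgroup H (Fp_mult p) \<and> K \<in> rcosets\<^bsub>Fp_mult p\<^esub> H \<and>
        \<nu> = map_pmf (\<lambda>c. scale p c V) (pmf_of_set K))"

end

theory Submission
  imports Defs
begin

text \<open>
  Write \<open>V = [A, B]\<close> and \<open>n = p - 1\<close>. Since \<open>tr(AV) = tr(BV) = 0\<close>, the triple product formula in \<open>sl\<^sub>2\<close> gives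
  \<open>[X, [Y, V]] = 2 tr(XY) V\<close> for \<open>X, Y \<in> {A, B}\<close> (\<open>double_bracket\<close>). Two steps of the walk thus multiply by
  \<open>\<alpha>\<close>, \<open>\<beta>\<close> or \<open>\<gamma>\<close> with probabilities \<open>1/2\<close>, \<open>1/4\<close>, \<open>1/4\<close>, and \<open>X\<^sub>2\<^sub>k = \<alpha>\<^sup>h \<beta>\<^sup>i \<gamma>\<^sup>j V\<close> for the random counts
  \<open>h + i + j = k\<close> of these factors (\<open>lie_bracket_pmf_even\<close>). Discrete logarithms turn this into a random walk
  on \<open>\<int>/n\<close> whose Fourier coefficients are \<open>\<lambda>\<^sub>j\<^sup>k\<close>.

  The coefficients of modulus \<open>1\<close> are those at the subgroup \<open>J\<close> of all \<open>j\<close> with \<open>n | j x\<close> and \<open>n | j y\<close>, where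
  \<open>x = \<beta>' - \<alpha>'\<close> and \<open>y = \<gamma>' - \<alpha>'\<close>. Therefore \<open>\<phi>\<^sub>k\<close> is uniform on the coset \<open>k \<alpha>' + J\<^sup>\<bottom>\<close>, which has \<open>n/|J|\<close> elements
  (\<open>phi_closed_form\<close>, \<open>card_annihilator_coset\<close>).

  Lower bound: two of the counts determine the third, and each of them stays within \<open>O(\<surd>k)\<close> of its mean.
  With high probability the walk is in a set of \<open>O(k)\<close> points, and for \<open>k < c p\<close> this is a small
  part of the coset, provided that \<open>|J|\<close> is bounded (\<open>tv_dist_limit_lower\<close>).

  Upper bound: by the Cauchy-Schwarz inequality and Parseval's identity, \<open>(2 d(\<mu>\<^sub>2\<^sub>k, \<nu>\<^sub>2\<^sub>k))\<^sup>2\<close> is at most the sum of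
  \<open>|\<lambda>\<^sub>j|\<^sup>2\<^sup>k\<close> over \<open>j \<notin> J\<close>, where \<open>|\<lambda>\<^sub>j|\<^sup>2 \<le> exp(-w\<^sub>j)\<close> with \<open>w\<^sub>j = (sin\<^sup>2(\<pi> j x/n) + sin\<^sup>2(\<pi> j y/n))/2\<close>. The sum of the
  \<open>exp(-k w\<^sub>j)\<close> can be large for special \<open>x\<close> and \<open>y\<close>, but its average over all \<open>x, y \<in> \<int>/n\<close> is at most \<open>12 n/k\<close>: for every single \<open>j\<close>
  the average is at most \<open>12/k\<close>, because with \<open>n = d m\<close>, \<open>d = gcd(j, n)\<close>, it is \<open>m\<^sup>-\<^sup>2\<close> times a sum of
  Gaussian type over the nonzero points of \<open>(\<int>/m)\<^sup>2\<close> (\<open>damp_sum_fixed_frequency\<close>). For \<open>k > C p\<close> Markov's inequality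
  leaves few bad pairs \<open>(x, y)\<close>. Likewise \<open>|J| > D\<close> only for a proportion \<open>1/D\<close> of the pairs, as \<open>x\<close>, \<open>y\<close> and \<open>n\<close> then
  have a common divisor above \<open>D\<close> (\<open>card_many_peaks\<close>).

  It remains to pass from uniform residues to uniform matrices. A triple \<open>(\<alpha>, \<beta>, \<gamma>)\<close> comes from at most
  \<open>4 p\<^sup>3\<close> of the \<open>p\<^sup>6\<close> pairs \<open>(A, B)\<close>, apart from a set of \<open>O(p\<^sup>5)\<close> degenerate pairs, because it prescribes two
  quadrics and a plane (\<open>card_pairs_with_forms\<close>, \<open>card_degenerate\<close>). So events that are rare for
  residues are rare for matrices (\<open>card_bad_pairs\<close>).
\<close>

section \<open>Brackets of traceless matrices\<close>

definition traceless :: "int \<Rightarrow> int \<Rightarrow> int \<Rightarrow> mat2" where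
  "traceless a b c = vector [vector [a, b], vector [c, - a]]"

lemma traceless_nth [simp]:
  "traceless a b c $ 1 $ 1 = a" "traceless a b c $ 1 $ 2 = b"
  "traceless a b c $ 2 $ 1 = c" "traceless a b c $ 2 $ 2 = - a"
  by (simp_all add: traceless_def)

lemmas mat2_simps = vec_eq_iff forall_2 matrix_matrix_mult_def sum_2 mat_mod_def bracket_def
  scale_def tr_def trace_def

lemma mat_mod_traceless_cong:
  assumes "[a = a'] (mod int p)" "[b = b'] (mod int p)" "[c = c'] (mod int p)"
  shows "mat_mod p (traceless a b c) = mat_mod p (traceless a' b' c')"
  using assms by (simp add: mat2_simps cong_def) (metis mod_minus_eq)

lemma mat_mod_traceless_eq_iff:
  assumes "a \<in> {0..<int p}" "b \<in> {0..<int p}" "c \<in> {0..<int p}"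
    "a' \<in> {0..<int p}" "b' \<in> {0..<int p}" "c' \<in> {0..<int p}"
  shows "mat_mod p (traceless a b c) = mat_mod p (traceless a' b' c') \<longleftrightarrow> a = a' \<and> b = b' \<and> c = c'"
  using assms by (auto simp: mat2_simps)

lemma bracket_mat_mod: "bracket p (mat_mod p X) (mat_mod p Y) = bracket p X Y"
  unfolding bracket_def mat_mod_def vec_eq_iff forall_2 matrix_matrix_mult_def sum_2
    vector_minus_component vec_lambda_beta cong_def[symmetric]
  by (intro conjI cong_diff cong_add cong_mult cong_mod_leftI cong_refl)

lemma tr_mat_mod: "tr p (mat_mod p X ** mat_mod p Y) = tr p (X ** Y)"
  unfolding tr_def trace_def mat_mod_def matrix_matrix_mult_def sum_2
    vec_lambda_beta cong_def[symmetric]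
  by (intro cong_add cong_mult cong_mod_leftI cong_refl)

lemma bracket_traceless:
  "bracket p (mat_mod p (traceless a b c)) (mat_mod p (traceless x y z))
    = mat_mod p (traceless (b * z - c * y) (2 * (a * y - b * x)) (2 * (c * x - a * z)))"
  unfolding bracket_mat_mod by (simp add: mat2_simps) (simp add: algebra_simps)

lemma scale_traceless:
  "scale p e (mat_mod p (traceless a b c)) = mat_mod p (traceless (e * a) (e * b) (e * c))"
  by (simp add: mat2_simps mod_simps)

lemma tr_traceless:
  "tr p (mat_mod p (traceless a b c) ** mat_mod p (traceless x y z)) = (2 * a * x + b * z + c * y) mod int p"
  unfolding tr_mat_mod by (simp add: mat2_simps) (simp add: algebra_simps)

lemma sl2_eq_traceless:
  assumes "p > 0"
  shows "sl2 p = (\<lambda>(a, b, c). mat_mod p (traceless a b c)) ` ({0..<int p} \<times> {0..<int p} \<times> {0..<int p})"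
proof -
  have "\<exists>a b c. a \<in> {0..<int p} \<and> b \<in> {0..<int p} \<and> c \<in> {0..<int p} \<and> 
    M = mat_mod p (traceless a b c)" if M: "M \<in> sl2 p" for M
  proof -
    have r: "0 \<le> M $ i $ j \<and> M $ i $ j < int p" for i j
      using M unfolding sl2_def residue_ring_def by auto
    have "int p dvd M $ 1 $ 1 + M $ 2 $ 2"
      using M by (auto simp: sl2_def tr_def trace_def sum_2)
    then have "int p dvd M $ 2 $ 2 - (- (M $ 1 $ 1))" by (simp add: add.commute)
    then have "M $ 2 $ 2 mod int p = (- (M $ 1 $ 1)) mod int p"
      by (simp only: mod_eq_dvd_iff)
    then show ?thesis using r
      by (intro exI[of _ "M$1$1"] exI[of _ "M$1$2"] exI[of _ "M$2$1"])
        (simp add: vec_eq_iff forall_2 mat_mod_def)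
  qed
  moreover have "mat_mod p (traceless a b c) \<in> sl2 p" for a b c
  proof -
    have "\<forall>i j. mat_mod p (traceless a b c) $ i $ j \<in> {0..int p - 1}"
      using assms by (auto simp: mat_mod_def zle_diff1_eq)
    then show ?thesis
      by (simp add: sl2_def residue_ring_def tr_def trace_def sum_2) (simp add: mat_mod_def mod_simps)
  qed
  ultimately show ?thesis by (fastforce simp: image_iff)
qed

text \<open>
  In \<open>sl\<^sub>2\<close> the bracket behaves like a cross product, and the analogue of the vector triple product
  formula is \<open>[X, [Y, V]] = 2 tr(XY) V - 2 tr(XV) Y\<close>. The hypothesis is the congruence \<open>tr(XV) = 0\<close>,
  so that only the first summand survives.
\<close>

lemma double_bracket_traceless:
  assumes "int p dvd 2 * a * d + b * f + c * e"
  shows "bracket p (mat_mod p (traceless a b c)) (bracket p (mat_mod p (traceless x y z)) (mat_mod p (traceless d e f)))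
    = scale p (2 * (2 * a * x + b * z + c * y)) (mat_mod p (traceless d e f))"
proof -
  obtain q where q: "2 * a * d + b * f + c * e = int p * q" using assms by auto
  have *: "[u = v] (mod int p)" if "v - u = 2 * (2 * a * d + b * f + c * e) * w" for u v w
    using that q by (simp add: cong_iff_dvd_diff dvd_diff_commute[of _ u])
  show ?thesis
    unfolding bracket_traceless scale_traceless
    by (rule mat_mod_traceless_cong[OF *[where w = x] *[where w = y] *[where w = z]])
      (simp_all add: algebra_simps)
qed

text \<open>
  Both \<open>A\<close> and \<open>B\<close> are orthogonal to \<open>[A, B]\<close> for the trace form, so two steps of the walk only
  multiply a point of the line through \<open>[A, B]\<close> by one of three scalars.
\<close>

lemma double_bracket:
  assumes "A \<in> sl2 p" "B \<in> sl2 p" "X \<in> {A, B}" "Y \<in> {A, B}" "p > 0"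
  shows "bracket p X (bracket p Y (scale p e (bracket p A B)))
       = scale p (e * (2 * tr p (X ** Y))) (bracket p A B)"
proof -
  obtain a b c where A: "A = mat_mod p (traceless a b c)"
    using assms(1,5) by (auto simp: sl2_eq_traceless)
  obtain x y z where B: "B = mat_mod p (traceless x y z)"
    using assms(2,5) by (auto simp: sl2_eq_traceless)
  obtain a' b' c' where X: "X = mat_mod p (traceless a' b' c')"
    and X': "(a', b', c') = (a, b, c) \<or> (a', b', c') = (x, y, z)" using assms(3) A B by auto
  obtain x' y' z' where Y: "Y = mat_mod p (traceless x' y' z')" using assms(4) A B by auto
  let ?V = "mat_mod p (traceless (e * (b * z - c * y)) (e * (2 * (a * y - b * x))) (e * (2 * (c * x - a * z))))"
  have "bracket p X (bracket p Y ?V) = scale p (2 * (2 * a' * x' + b' * z' + c' * y')) ?V"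
    unfolding X Y
    by (rule double_bracket_traceless) (use X' in \<open>auto simp: algebra_simps\<close>)
  also have "\<dots> = scale p (e * (2 * tr p (X ** Y))) (bracket p A B)"
  proof -
    have "[2 * (2 * a' * x' + b' * z' + c' * y') * (e * v)
       = e * (2 * ((2 * a' * x' + b' * z' + c' * y') mod int p)) * v] (mod int p)" for v
    proof -
      have "[e * (2 * ((2 * a' * x' + b' * z' + c' * y') mod int p)) * v
         = e * (2 * (2 * a' * x' + b' * z' + c' * y')) * v] (mod int p)"
        by (intro cong_mult cong_refl cong_mod_leftI)
      then show ?thesis by (simp only: cong_sym_eq ac_simps)
    qed
    then show ?thesis
      unfolding A B X Y tr_traceless bracket_traceless scale_traceless
      by (intro mat_mod_traceless_cong)
  qed
  finally show ?thesis by (simp add: A B bracket_traceless scale_traceless)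
qed

section \<open>The walk as a random monomial\<close>

lemma scale_cong: "[e = e'] (mod int p) \<Longrightarrow> scale p e V = scale p e' V"
  by (simp add: scale_def vec_eq_iff cong_def) (metis mod_mult_left_eq)

lemma lie_walk_cong: "(\<And>i. i \<in> {1..k} \<Longrightarrow> Z i = Z' i) \<Longrightarrow> lie_walk p A B Z k = lie_walk p A B Z' k"
  by (induction k) auto

lemma lie_bracket_pmf_Suc:
  "lie_bracket_pmf p A B (Suc k) =
    bind_pmf (lie_bracket_pmf p A B k) (\<lambda>X. map_pmf (\<lambda>Z. bracket p Z X) (step_pmf A B))"
proof -
  have walk: "lie_walk p A B (f(Suc k := y)) (Suc k) = bracket p y (lie_walk p A B f k)" for f y
    using lie_walk_cong[of k "f(Suc k := y)" f p A B] by simp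
  have "lie_bracket_pmf p A B (Suc k) =
    map_pmf (\<lambda>(y, f). lie_walk p A B (f(Suc k := y)) (Suc k))
      (pair_pmf (step_pmf A B) (Pi_pmf {1..k} 0 (\<lambda>_. step_pmf A B)))"
  proof -
    have ins: "{1..Suc k} = insert (Suc k) {1..k}" by auto
    show ?thesis
      unfolding lie_bracket_pmf_def ins
      by (subst Pi_pmf_insert) (auto simp: pmf.map_comp o_def case_prod_unfold)
  qed
  also have "\<dots> = bind_pmf (lie_bracket_pmf p A B k) (\<lambda>X. map_pmf (\<lambda>Z. bracket p Z X) (step_pmf A B))"
    unfolding walk lie_bracket_pmf_def pair_pmf_def
    by (subst bind_commute_pmf) (simp add: map_pmf_def bind_assoc_pmf bind_return_pmf)
  finally show ?thesis .
qed

abbreviation coin :: "bool pmf" where "coin \<equiv> bernoulli_pmf (1/2)"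

text \<open>
  The three components count how often the double step used two different letters, twice \<open>A\<close>, and
  twice \<open>B\<close>; these are the exponents of \<open>\<alpha>\<close>, \<open>\<beta>\<close> and \<open>\<gamma>\<close>.
\<close>

primrec count_walk :: "nat \<Rightarrow> (nat \<times> nat \<times> nat) pmf" where
  "count_walk 0 = return_pmf (0, 0, 0)"
| "count_walk (Suc k) = bind_pmf (count_walk k) (\<lambda>(h, i, j). bind_pmf coin (\<lambda>s. bind_pmf coin (\<lambda>t.
     return_pmf (if s \<noteq> t then (Suc h, i, j) else if s then (h, Suc i, j) else (h, i, Suc j)))))"

lemma lie_bracket_pmf_even:
  assumes "A \<in> sl2 p" "B \<in> sl2 p" "p > 0"
    and "[\<alpha> = 2 * tr p (A ** B)] (mod int p)" "[\<beta> = 2 * tr p (A ** A)] (mod int p)"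
    and "[\<gamma> = 2 * tr p (B ** B)] (mod int p)"
  shows "lie_bracket_pmf p A B (2 * k) =
    map_pmf (\<lambda>(h, i, j). scale p (\<alpha> ^ h * \<beta> ^ i * \<gamma> ^ j) (bracket p A B)) (count_walk k)"
proof (induction k)
  case 0
  have "bracket p A B = scale p 1 (bracket p A B)"
    by (simp add: bracket_def scale_def mat_mod_def vec_eq_iff)
  then show ?case by (simp add: lie_bracket_pmf_def)
next
  case (Suc k)
  let ?V = "bracket p A B"
  have trBA: "tr p (B ** A) = tr p (A ** B)"
    by (simp add: mat2_simps algebra_simps)
  have step: "bracket p (if t then A else B) (bracket p (if s then A else B)
        (scale p (\<alpha> ^ h * \<beta> ^ i * \<gamma> ^ j) ?V))
     = (\<lambda>(h, i, j). scale p (\<alpha> ^ h * \<beta> ^ i * \<gamma> ^ j) ?V)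
         (if s \<noteq> t then (Suc h, i, j) else if s then (h, Suc i, j) else (h, i, Suc j))" for s t h i j
  proof -
    have "bracket p (if t then A else B) (bracket p (if s then A else B)
        (scale p (\<alpha> ^ h * \<beta> ^ i * \<gamma> ^ j) ?V)) =
       scale p ((\<alpha> ^ h * \<beta> ^ i * \<gamma> ^ j) *
         (2 * tr p ((if t then A else B) ** (if s then A else B)))) ?V"
      by (rule double_bracket) (use assms in auto)
    also have "\<dots> = scale p ((\<alpha> ^ h * \<beta> ^ i * \<gamma> ^ j) * (if s \<noteq> t then \<alpha> else if s then \<beta> else \<gamma>)) ?V"
      by (rule scale_cong, rule cong_mult[OF cong_refl]) (use assms(4-6) in \<open>auto simp: trBA cong_sym\<close>)
    finally show ?thesis by (auto simp: mult_ac)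
  qed
  have "2 * Suc k = Suc (Suc (2 * k))" by simp
  then show ?case
    unfolding step_pmf_def \<open>2 * Suc k = _\<close> lie_bracket_pmf_Suc Suc.IH count_walk.simps
    by (simp add: map_pmf_def bind_assoc_pmf bind_return_pmf case_prod_unfold step[unfolded case_prod_unfold])
qed

lemma finite_count_walk: "finite (set_pmf (count_walk k))"
  by (induction k) (auto simp: case_prod_unfold)

lemma count_walk_total: "(h, i, j) \<in> set_pmf (count_walk k) \<Longrightarrow> h + i + j = k"
  by (induction k arbitrary: h i j) (auto split: if_splits)

lemma expectation_coin:
  fixes f :: "bool \<Rightarrow> 'a :: {banach, second_countable_topology}"
  shows "measure_pmf.expectation coin f = (1/2) *\<^sub>R f True + (1/2) *\<^sub>R f False"
  by (subst integral_measure_pmf[of UNIV]) (auto simp: UNIV_bool)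

lemma expectation_bind_finite:
  fixes f :: "'b \<Rightarrow> 'a :: {banach, second_countable_topology}"
  assumes "finite (set_pmf q)" "\<And>x. x \<in> set_pmf q \<Longrightarrow> finite (set_pmf (g x))"
  shows "measure_pmf.expectation (bind_pmf q g) f
     = measure_pmf.expectation q (\<lambda>x. measure_pmf.expectation (g x) f)"
  by (subst pmf_expectation_bind[OF assms(1)]) (use assms in \<open>auto simp: integral_measure_pmf[OF assms(1)]\<close>)

lemma expectation_count_walk_Suc:
  fixes f :: "nat \<times> nat \<times> nat \<Rightarrow> 'a :: {banach, second_countable_topology}"
  shows "measure_pmf.expectation (count_walk (Suc k)) f = measure_pmf.expectation (count_walk k)
    (\<lambda>(h, i, j). (1/2) *\<^sub>R f (Suc h, i, j) + (1/4) *\<^sub>R f (h, Suc i, j) + (1/4) *\<^sub>R f (h, i, Suc j))"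
  unfolding count_walk.simps
  by (subst expectation_bind_finite[OF finite_count_walk])
    (auto simp: case_prod_unfold expectation_bind_finite expectation_coin scaleR_right_distrib
      scaleR_add_left[symmetric] intro!: Bochner_Integration.integral_cong)

text \<open>
  The second and third counts are binomial with parameters \<open>k\<close> and \<open>1/4\<close>, so each has variance
  \<open>3k/16\<close>. A step adds an independent centred increment, which makes the sum of the two variances
  grow by \<open>3/8\<close> whatever the present position.
\<close>

lemma count_walk_variance:
  "measure_pmf.expectation (count_walk k)
     (\<lambda>(h, i, j). (real i - real k / 4)\<^sup>2 + (real j - real k / 4)\<^sup>2) = 3 * real k / 8"
proof (induction k)
  case (Suc k)
  have int: "integrable (measure_pmf (count_walk k)) f" for f :: "_ \<Rightarrow> real"
    by (rule integrable_measure_pmf_finite[OF finite_count_walk])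
  have "measure_pmf.expectation (count_walk (Suc k))
     (\<lambda>(h, i, j). (real i - real (Suc k) / 4)\<^sup>2 + (real j - real (Suc k) / 4)\<^sup>2)
    = measure_pmf.expectation (count_walk k)
     (\<lambda>x. (case x of (h, i, j) \<Rightarrow> (real i - real k / 4)\<^sup>2 + (real j - real k / 4)\<^sup>2) + 3 / 8)"
    unfolding expectation_count_walk_Suc
    by (rule Bochner_Integration.integral_cong)
       (auto simp: power2_eq_square field_simps)
  also have "\<dots> = 3 * real k / 8 + 3 / 8"
    by (subst Bochner_Integration.integral_add) (auto simp: int Suc.IH)
  finally show ?case by (simp add: field_simps)
qed simp

section \<open>Characters of the integers modulo n\<close>

abbreviation Zn :: "nat \<Rightarrow> int set" where "Zn n \<equiv> {0..<int n}"

lemma chi_cis: "chi n j x = cis (2 * pi * of_int j * of_int x / of_nat n)"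
  by (simp add: chi_def cis_conv_exp mult_ac)

lemma chi_0 [simp]: "chi n j 0 = 1" "chi n 0 x = 1"
  by (simp_all add: chi_def)

lemma chi_add: "chi n j (x + y) = chi n j x * chi n j y"
  by (simp add: chi_cis cis_mult add_divide_distrib distrib_left)

lemma chi_add_left: "chi n (i + j) x = chi n i x * chi n j x"
  by (simp add: chi_cis cis_mult add_divide_distrib distrib_left distrib_right)

lemma cnj_chi: "cnj (chi n j x) = chi n j (- x)"
  by (simp add: chi_cis cis_cnj)

lemma chi_minus_left: "chi n (- j) x = chi n j (- x)"
  by (simp add: chi_def)

lemma norm_chi [simp]: "cmod (chi n j x) = 1"
  by (simp add: chi_cis)

lemma chi_of_nat_mult: "chi n j (int k * x) = chi n j x ^ k"
  by (induction k) (simp_all add: chi_add distrib_right)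

lemma chi_eq_1_iff:
  assumes "n > 0"
  shows "chi n j x = 1 \<longleftrightarrow> int n dvd j * x"
proof -
  have "chi n j x = 1 \<longleftrightarrow> (\<exists>m::int. 2 * pi * of_int j * of_int x / of_nat n = of_int (2 * m) * pi)"
    unfolding chi_def by (subst exp_eq_1) auto
  also have "\<dots> \<longleftrightarrow> (\<exists>m::int. real_of_int (j * x) = real_of_int (int n * m))"
    using assms by (intro ex_cong1) (auto simp: field_simps)
  also have "\<dots> \<longleftrightarrow> int n dvd j * x"
    unfolding of_int_eq_iff dvd_def ..
  finally show ?thesis .
qed

lemma chi_cong:
  assumes "n > 0" "[x = y] (mod int n)"
  shows "chi n j x = chi n j y"
proof -
  have "chi n j (x - y) = 1"
    using assms by (simp add: chi_eq_1_iff cong_iff_dvd_diff)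
  then show ?thesis
    using chi_add[of n j "x - y" y] by simp
qed

lemma chi_sym: "chi n j x = chi n x j"
  by (simp add: chi_def mult_ac)

lemma chi_cong_left: "n > 0 \<Longrightarrow> [i = j] (mod int n) \<Longrightarrow> chi n i x = chi n j x"
  by (metis chi_sym chi_cong)

text \<open>
  Adding an element \<open>g\<close> permutes a subgroup \<open>G\<close> of \<open>\<int>/n\<close> and multiplies the sum by \<open>\<chi>\<^sub>g(x)\<close>. If some
  \<open>\<chi>\<^sub>g(x)\<close> is not \<open>1\<close> the sum has to vanish, and otherwise all its terms are \<open>1\<close>.
\<close>

lemma chi_sum_closed:
  assumes n: "n > 0" and sub: "G \<subseteq> Zn n" and closed: "\<And>g h. g \<in> G \<Longrightarrow> h \<in> G \<Longrightarrow> (g + h) mod int n \<in> G"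
  shows "(\<Sum>j\<in>G. chi n j x) = (if \<forall>j\<in>G. int n dvd j * x then of_nat (card G) else 0)"
proof (cases "\<forall>j\<in>G. int n dvd j * x")
  case True
  then show ?thesis using n by (auto simp: chi_eq_1_iff[symmetric] cong: sum.cong)
next
  case False
  then obtain g where g: "g \<in> G" "chi n g x \<noteq> 1"
    using n by (auto simp: chi_eq_1_iff)
  have fin: "finite G" by (rule finite_subset[OF sub]) simp
  have inj: "inj_on (\<lambda>j. (g + j) mod int n) G"
  proof
    fix i j assume "i \<in> G" "j \<in> G" "(g + i) mod int n = (g + j) mod int n"
    then have "[i = j] (mod int n)" by (simp only: cong_add_lcancel flip: cong_def)
    moreover have "i \<in> Zn n" "j \<in> Zn n" using \<open>i \<in> G\<close> \<open>j \<in> G\<close> sub by auto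
    ultimately show "i = j" by (simp add: cong_def)
  qed
  have "(\<lambda>j. (g + j) mod int n) ` G = G"
    by (rule endo_inj_surj[OF fin _ inj]) (use closed g in auto)
  then have "(\<Sum>j\<in>G. chi n j x) = (\<Sum>j\<in>G. chi n ((g + j) mod int n) x)"
    using sum.reindex[OF inj, of "\<lambda>j. chi n j x"] by (simp add: o_def)
  also have "\<dots> = chi n g x * (\<Sum>j\<in>G. chi n j x)"
  proof -
    have "chi n ((g + j) mod int n) x = chi n g x * chi n j x" for j
      using chi_cong_left[OF n, of "(g + j) mod int n" "g + j"] by (simp add: chi_add_left)
    then show ?thesis by (simp add: sum_distrib_left)
  qed
  finally have "(1 - chi n g x) * (\<Sum>j\<in>G. chi n j x) = 0" by (simp add: algebra_simps)
  then have "(\<Sum>j\<in>G. chi n j x) = 0" using g(2) by simp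
  then show ?thesis using False by (simp only: if_False)
qed

lemma chi_sum_Zn:
  assumes "n > 0"
  shows "(\<Sum>j\<in>Zn n. chi n j x) = (if int n dvd x then of_nat n else 0)"
proof -
  have "(\<forall>j\<in>Zn n. int n dvd j * x) \<longleftrightarrow> int n dvd x"
  proof
    assume *: "\<forall>j\<in>Zn n. int n dvd j * x"
    show "int n dvd x"
    proof (cases "n = 1")
      case False
      then show ?thesis using *[rule_format, of 1] assms by simp
    qed simp
  qed auto
  then show ?thesis
    using chi_sum_closed[OF assms, of "Zn n" x] assms by auto
qed

lemma parseval:
  assumes "n > 0" "U \<subseteq> Zn n"
  shows "(\<Sum>x\<in>Zn n. (cmod (\<Sum>j\<in>U. f j * chi n j x))\<^sup>2) = n * (\<Sum>j\<in>U. (cmod (f j))\<^sup>2)"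
proof -
  have fin: "finite U" by (rule finite_subset[OF assms(2)]) simp
  have *: "(\<Sum>x\<in>Zn n. chi n i x * chi n j (- x)) = (if i = j then of_nat n else 0)"
    if "i \<in> U" "j \<in> U" for i j
  proof -
    have "(\<Sum>x\<in>Zn n. chi n i x * chi n j (- x)) = (\<Sum>x\<in>Zn n. chi n x (i - j))"
    proof (rule sum.cong[OF refl])
      fix x
      show "chi n i x * chi n j (- x) = chi n x (i - j)"
        using chi_add[of n x i "- j"]
        by (simp add: chi_sym[of n x i] chi_sym[of n x "- j"] chi_minus_left)
    qed
    also have "\<dots> = (if int n dvd i - j then of_nat n else 0)"
      by (rule chi_sum_Zn[OF assms(1)])
    also have "int n dvd i - j \<longleftrightarrow> i = j"
    proof -
      have "i \<in> Zn n" "j \<in> Zn n" using that assms(2) by auto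
      then show ?thesis by (simp add: mod_eq_dvd_iff[symmetric])
    qed
    finally show ?thesis .
  qed
  have "complex_of_real (\<Sum>x\<in>Zn n. (cmod (\<Sum>j\<in>U. f j * chi n j x))\<^sup>2)
    = (\<Sum>x\<in>Zn n. (\<Sum>i\<in>U. f i * chi n i x) * (\<Sum>j\<in>U. cnj (f j) * chi n j (- x)))"
    by (simp only: of_real_sum complex_norm_square cnj_sum complex_cnj_mult cnj_chi)
  also have "\<dots> = (\<Sum>x\<in>Zn n. \<Sum>i\<in>U. \<Sum>j\<in>U. f i * cnj (f j) * (chi n i x * chi n j (- x)))"
    unfolding sum_product by (intro sum.cong refl) (simp only: mult_ac)
  also have "\<dots> = (\<Sum>i\<in>U. \<Sum>x\<in>Zn n. \<Sum>j\<in>U. f i * cnj (f j) * (chi n i x * chi n j (- x)))"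
    by (rule sum.swap)
  also have "\<dots> = (\<Sum>i\<in>U. \<Sum>j\<in>U. f i * cnj (f j) * (\<Sum>x\<in>Zn n. chi n i x * chi n j (- x)))"
    unfolding sum_distrib_left by (intro sum.cong[OF refl] sum.swap)
  also have "\<dots> = (\<Sum>i\<in>U. \<Sum>j\<in>U. if i = j then of_nat n * (f i * cnj (f i)) else 0)"
    by (rule sum.cong[OF refl], rule sum.cong[OF refl]) (auto simp: *)
  also have "\<dots> = (\<Sum>i\<in>U. of_nat n * (f i * cnj (f i)))"
    using fin by (simp add: sum.delta)
  also have "\<dots> = complex_of_real (n * (\<Sum>j\<in>U. (cmod (f j))\<^sup>2))"
    by (simp only: of_real_mult of_real_sum complex_norm_square sum_distrib_left of_real_of_nat_eq)
  finally show ?thesis using of_real_eq_iff by blast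
qed

section \<open>The Fourier coefficients of a step\<close>

text \<open>
  Here \<open>x\<close> and \<open>y\<close> stand for \<open>\<beta>' - \<alpha>'\<close> and \<open>\<gamma>' - \<alpha>'\<close>. After the factor \<open>\<chi>\<^sub>j(-\<alpha>')\<close> is taken out, \<open>\<lambda>\<^sub>j\<close> is the
  mean of \<open>(1 + \<chi>\<^sub>j(-x))/2\<close> and \<open>(1 + \<chi>\<^sub>j(-y))/2\<close>, whose squared moduli are \<open>1 - sin\<^sup>2\<close> of the two angles
  below; their average deficit bounds \<open>1 - |\<lambda>\<^sub>j|\<^sup>2\<close> from below.
\<close>

definition decay :: "nat \<Rightarrow> int \<Rightarrow> int \<Rightarrow> int \<Rightarrow> real" where
  "decay n x y j = ((sin (pi * of_int (j * x) / n))\<^sup>2 + (sin (pi * of_int (j * y) / n))\<^sup>2) / 2"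

lemma decay_nonneg: "decay n x y j \<ge> 0"
  by (simp add: decay_def)

lemma sin_eq_0_iff_dvd:
  assumes "n > 0"
  shows "sin (pi * of_int m / real n) = 0 \<longleftrightarrow> int n dvd m"
proof -
  have "sin (pi * of_int m / real n) = 0 \<longleftrightarrow> (\<exists>i::int. real_of_int m = real_of_int (int n * i))"
    unfolding sin_zero_iff_int2 using assms by (intro ex_cong1) (auto simp: field_simps)
  also have "\<dots> \<longleftrightarrow> int n dvd m"
    unfolding of_int_eq_iff dvd_def ..
  finally show ?thesis .
qed

lemma decay_eq_0_iff:
  assumes "n > 0"
  shows "decay n x y j = 0 \<longleftrightarrow> int n dvd j * x \<and> int n dvd j * y"
  using sin_eq_0_iff_dvd[OF assms, of "j * x"] sin_eq_0_iff_dvd[OF assms, of "j * y"]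
  by (simp add: decay_def add_nonneg_eq_0_iff)

lemma norm_1_plus_chi:
  "(cmod ((1 + chi n j (- x)) / 2))\<^sup>2 = 1 - (sin (pi * of_int (j * x) / n))\<^sup>2"
proof -
  define t where "t = pi * of_int (j * x) / n"
  have "chi n j (- x) = cis (- (2 * t))" by (simp add: chi_cis t_def mult_ac)
  then have "(cmod ((1 + chi n j (- x)) / 2))\<^sup>2 = ((1 + cos (2 * t))\<^sup>2 + (sin (2 * t))\<^sup>2) / 4"
    by (simp add: cmod_power2 power_divide)
  also have "\<dots> = (cos t)\<^sup>2 * ((cos t)\<^sup>2 + (sin t)\<^sup>2)"
  proof -
    have "((1 + (2 * C\<^sup>2 - 1))\<^sup>2 + (2 * S * C)\<^sup>2) / 4 = C\<^sup>2 * (C\<^sup>2 + S\<^sup>2)" for C S :: real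
      by (simp add: power2_eq_square algebra_simps)
    then show ?thesis unfolding cos_double_cos sin_double by blast
  qed
  also have "\<dots> = 1 - (sin t)\<^sup>2" by (simp add: cos_squared_eq)
  finally show ?thesis by (simp add: t_def)
qed

lemma norm_average_le: "(cmod ((z + w) / 2))\<^sup>2 \<le> ((cmod z)\<^sup>2 + (cmod w)\<^sup>2) / 2"
proof -
  have "(cmod (z + w))\<^sup>2 \<le> (cmod z + cmod w)\<^sup>2"
    by (intro power_mono norm_triangle_ineq) auto
  also have "\<dots> \<le> 2 * ((cmod z)\<^sup>2 + (cmod w)\<^sup>2)"
    using zero_le_power2[of "cmod z - cmod w"] by (simp add: power2_eq_square algebra_simps)
  finally show ?thesis by (simp add: norm_divide power_divide)
qed

lemma norm_lam_le: "(cmod (lam n a b c j))\<^sup>2 \<le> 1 - decay n (b - a) (c - a) j"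
proof -
  have *: "chi n j (- x) = chi n j (- a) * chi n j (- (x - a))" for x
    by (simp add: chi_add[symmetric])
  have "lam n a b c j = chi n j (- a) * (((1 + chi n j (- (b - a))) / 2 + (1 + chi n j (- (c - a))) / 2) / 2)"
    unfolding lam_def *[of b] *[of c] by (simp add: field_simps)
  then have "(cmod (lam n a b c j))\<^sup>2
      = (cmod (((1 + chi n j (- (b - a))) / 2 + (1 + chi n j (- (c - a))) / 2) / 2))\<^sup>2"
    by (simp only: norm_mult norm_chi mult_1)
  also have "\<dots> \<le> 1 - decay n (b - a) (c - a) j"
    unfolding decay_def
    by (rule order.trans[OF norm_average_le]) (simp only: norm_1_plus_chi, simp add: field_simps)
  finally show ?thesis .
qed

lemma lam_eq_chi:
  assumes "n > 0" "int n dvd j * (b - a)" "int n dvd j * (c - a)"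
  shows "lam n a b c j = chi n j (- a)"
proof -
  have "chi n j (- (b - a)) = 1" "chi n j (- (c - a)) = 1"
    using assms by (simp_all only: chi_eq_1_iff mult_minus_right dvd_minus_iff)
  then have "chi n j (- b) = chi n j (- a)" "chi n j (- c) = chi n j (- a)"
    using chi_add[of n j "- (b - a)" "- a"] chi_add[of n j "- (c - a)" "- a"] by auto
  then show ?thesis by (simp add: lam_def)
qed

text \<open>
  These are the frequencies with \<open>|\<lambda>\<^sub>j| = 1\<close>. They form a subgroup of \<open>\<int>/n\<close>, and its annihilator is the
  subgroup generated by \<open>x\<close> and \<open>y\<close>, on a coset of which the walk lives.
\<close>

definition peaks :: "nat \<Rightarrow> int \<Rightarrow> int \<Rightarrow> int set" where
  "peaks n x y = {j \<in> Zn n. int n dvd j * x \<and> int n dvd j * y}"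

lemma peaks_subset: "peaks n x y \<subseteq> Zn n" by (auto simp: peaks_def)

lemma finite_peaks [simp]: "finite (peaks n x y)"
  by (rule finite_subset[OF peaks_subset]) simp

lemma zero_in_peaks: "n > 0 \<Longrightarrow> 0 \<in> peaks n x y"
  by (simp add: peaks_def)

lemma peaks_closed:
  "n > 0 \<Longrightarrow> g \<in> peaks n x y \<Longrightarrow> h \<in> peaks n x y \<Longrightarrow> (g + h) mod int n \<in> peaks n x y"
proof -
  have "int n dvd ((g + h) mod int n) * z \<longleftrightarrow> int n dvd g * z + h * z" for z
    unfolding distrib_right[symmetric]
    by (rule cong_dvd_iff, rule cong_mult[OF cong_mod_leftI cong_refl]) simp
  then show "n > 0 \<Longrightarrow> g \<in> peaks n x y \<Longrightarrow> h \<in> peaks n x y \<Longrightarrow> (g + h) mod int n \<in> peaks n x y"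
    by (auto simp: peaks_def)
qed

text \<open>
  A unimodular \<open>\<lambda>\<^sub>j\<close> leaves no room for decay, which forces both sines to vanish.
\<close>

lemma norm_lam_eq_1_iff:
  assumes "n > 0"
  shows "cmod (lam n a b c j) = 1 \<longleftrightarrow> int n dvd j * (b - a) \<and> int n dvd j * (c - a)"
proof
  assume "cmod (lam n a b c j) = 1"
  then have "decay n (b - a) (c - a) j \<le> 0"
    using norm_lam_le[of n a b c j] by simp
  then show "int n dvd j * (b - a) \<and> int n dvd j * (c - a)"
    using decay_nonneg[of n "b - a" "c - a" j] decay_eq_0_iff[OF assms, of "b - a" "c - a" j] by simp
qed (simp add: lam_eq_chi[OF assms])

lemma peaks_eq_lam:
  "n > 0 \<Longrightarrow> {j \<in> carrier (integer_mod_group n). cmod (lam n a b c j) = 1} = peaks n (b - a) (c - a)"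
  by (auto simp: peaks_def norm_lam_eq_1_iff carrier_integer_mod_group)

definition annihilator :: "nat \<Rightarrow> int set \<Rightarrow> int set" where
  "annihilator n J = {z. \<forall>j\<in>J. int n dvd j * z}"

text \<open>
  On the peaks \<open>\<lambda>\<^sub>j = \<chi>\<^sub>j(-a)\<close>, so that \<open>\<phi>\<^sub>k(z)\<close> is a character sum over a subgroup at \<open>z - k a\<close>. This
  makes \<open>\<phi>\<^sub>k\<close> a uniform distribution on a coset of the annihilator.
\<close>

lemma phi_closed_form:
  assumes "n > 0"
  shows "phi n a b c k z = (if z - int k * a \<in> annihilator n (peaks n (b - a) (c - a))
    then card (peaks n (b - a) (c - a)) / n else 0)"
proof -
  let ?J = "peaks n (b - a) (c - a)"
  have "(\<Sum>j\<in>?J. lam n a b c j ^ k * chi n j z) = (\<Sum>j\<in>?J. chi n j (z - int k * a))"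
  proof (rule sum.cong[OF refl])
    fix j assume "j \<in> ?J"
    then have "lam n a b c j = chi n j (- a)"
      by (intro lam_eq_chi[OF assms]) (auto simp: peaks_def)
    then show "lam n a b c j ^ k * chi n j z = chi n j (z - int k * a)"
      using chi_add[of n j "int k * (- a)" z] chi_of_nat_mult[of n j k "- a"]
      by (simp add: algebra_simps)
  qed
  also have "\<dots> = (if z - int k * a \<in> annihilator n ?J then of_nat (card ?J) else 0)"
    unfolding annihilator_def mem_Collect_eq
    by (rule chi_sum_closed[OF assms peaks_subset]) (rule peaks_closed[OF assms])
  finally show ?thesis
    by (simp add: phi_def peaks_eq_lam[OF assms])
qed

text \<open>
  Summing the character sums over all \<open>z\<close> in two ways: only the frequency \<open>0\<close> contributes when the sum
  over \<open>z\<close> is taken first.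
\<close>

lemma card_annihilator_coset:
  fixes x y u :: int
  assumes "n > 0"
  defines "J \<equiv> peaks n x y"
  shows "card {z \<in> Zn n. z - u \<in> annihilator n J} * card J = n"
proof -
  have "of_nat (card {z \<in> Zn n. z - u \<in> annihilator n J} * card J)
      = (\<Sum>z\<in>Zn n. if z - u \<in> annihilator n J then of_nat (card J) else (0::complex))"
    by (simp add: sum.If_cases Int_def)
  also have "\<dots> = (\<Sum>z\<in>Zn n. \<Sum>j\<in>J. chi n j (z - u))"
    unfolding annihilator_def mem_Collect_eq J_def
    by (intro sum.cong refl chi_sum_closed[OF assms(1) peaks_subset, symmetric] peaks_closed[OF assms(1)])
  also have "\<dots> = (\<Sum>j\<in>J. chi n j (- u) * (\<Sum>z\<in>Zn n. chi n z j))"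
  proof -
    have "chi n j (z - u) = chi n j (- u) * chi n z j" for j z
      using chi_add[of n j "- u" z] by (simp add: chi_sym[of n z j])
    then show ?thesis by (subst sum.swap) (simp add: sum_distrib_left)
  qed
  also have "\<dots> = (\<Sum>j\<in>J. if j = 0 then of_nat n else 0)"
  proof (rule sum.cong[OF refl])
    fix j assume "j \<in> J"
    then have "int n dvd j \<longleftrightarrow> j = 0" by (auto simp: J_def peaks_def dest: zdvd_imp_le)
    then show "chi n j (- u) * (\<Sum>z\<in>Zn n. chi n z j) = (if j = 0 then of_nat n else 0)"
      by (auto simp: chi_sum_Zn[OF assms(1)])
  qed
  also have "\<dots> = of_nat n"
    using zero_in_peaks[OF assms(1)] by (simp add: J_def)
  finally show ?thesis by (simp only: of_nat_eq_iff)
qed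

section \<open>The walk modulo n and its limit\<close>

definition walk_residue :: "nat \<Rightarrow> int \<Rightarrow> int \<Rightarrow> int \<Rightarrow> nat \<times> nat \<times> nat \<Rightarrow> int" where
  "walk_residue n a b c = (\<lambda>(h, i, j). (int h * a + int i * b + int j * c) mod int n)"

lemma expectation_chi_walk:
  assumes "n > 0"
  shows "measure_pmf.expectation (count_walk k) (\<lambda>s. chi n j (- walk_residue n a b c s)) = lam n a b c j ^ k"
proof (induction k)
  case (Suc k)
  have step: "chi n j (- walk_residue n a b c (h, i, l)) =
    chi n j (- a) ^ h * chi n j (- b) ^ i * chi n j (- c) ^ l" for h i l
  proof -
    have "chi n j (- walk_residue n a b c (h, i, l)) = chi n j (int h * (- a) + int i * (- b) + int l * (- c))"
      by (rule chi_cong[OF assms]) (simp add: walk_residue_def cong_def mod_minus_eq)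
    then show ?thesis by (simp only: chi_add chi_of_nat_mult)
  qed
  have "measure_pmf.expectation (count_walk (Suc k)) (\<lambda>s. chi n j (- walk_residue n a b c s))
     = measure_pmf.expectation (count_walk k) (\<lambda>s. lam n a b c j * chi n j (- walk_residue n a b c s))"
    unfolding expectation_count_walk_Suc
    by (rule Bochner_Integration.integral_cong)
       (auto simp: step lam_def scaleR_conv_of_real algebra_simps)
  then show ?case by (simp add: Suc.IH)
qed (simp add: walk_residue_def)

text \<open>
  Fourier inversion, with the indicator of a point expanded into characters.
\<close>

lemma pmf_walk:
  assumes "n > 0" "z \<in> Zn n"
  shows "complex_of_real (pmf (map_pmf (walk_residue n a b c) (count_walk k)) z)
    = (\<Sum>j\<in>Zn n. lam n a b c j ^ k * chi n j z) / n"
proof -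
  have int: "integrable (measure_pmf (count_walk k)) f" for f :: "_ \<Rightarrow> complex"
    by (rule integrable_measure_pmf_finite[OF finite_count_walk])
  have ind: "(\<Sum>j\<in>Zn n. chi n j z * chi n j (- walk_residue n a b c s)) / n
      = complex_of_real (indicator (walk_residue n a b c -` {z}) s)" for s
  proof -
    have "walk_residue n a b c s \<in> Zn n" using assms by (auto simp: walk_residue_def split: prod.splits)
    then have "int n dvd z - walk_residue n a b c s \<longleftrightarrow> walk_residue n a b c s = z"
      using assms by (auto simp: mod_eq_dvd_iff[symmetric])
    then show ?thesis
      using assms by (simp add: chi_add[symmetric] chi_sum_Zn indicator_def)
  qed
  have "(\<Sum>j\<in>Zn n. lam n a b c j ^ k * chi n j z) / n
    = measure_pmf.expectation (count_walk k) 
        (\<lambda>s. (\<Sum>j\<in>Zn n. chi n j z * chi n j (- walk_residue n a b c s)) / n)"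
    by (simp add: int Bochner_Integration.integral_sum expectation_chi_walk[OF assms(1)] mult.commute)
  also have "\<dots> = complex_of_real (pmf (map_pmf (walk_residue n a b c) (count_walk k)) z)"
    unfolding ind pmf_map integral_complex_of_real by simp
  finally show ?thesis ..
qed

text \<open>
  The walk and its limit have the same Fourier coefficients at the peaks. The Cauchy-Schwarz inequality
  and Parseval's identity bound the distance by the remaining coefficients, each of which is at most
  \<open>exp(-k w\<^sub>j)\<close> in absolute square, where \<open>w\<^sub>j\<close> is the decay at \<open>j\<close>.
\<close>

lemma walk_l1_bound:
  assumes "n > 0"
  shows "(\<Sum>z\<in>Zn n. cmod (complex_of_real (pmf (map_pmf (walk_residue n a b c) (count_walk k)) z) - phi n a b c k z))\<^sup>2
    \<le> (\<Sum>j\<in>Zn n - peaks n (b - a) (c - a). exp (- (real k * decay n (b - a) (c - a) j)))"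
proof -
  let ?J = "peaks n (b - a) (c - a)"
  define D where "D z = complex_of_real (pmf (map_pmf (walk_residue n a b c) (count_walk k)) z) - phi n a b c k z" for z
  have D: "D z = (\<Sum>j\<in>Zn n - ?J. (lam n a b c j ^ k / n) * chi n j z)" if "z \<in> Zn n" for z
  proof -
    have "D z = (\<Sum>j\<in>Zn n - ?J. lam n a b c j ^ k * chi n j z) / n"
      unfolding D_def pmf_walk[OF assms that] phi_def peaks_eq_lam[OF assms] diff_divide_distrib[symmetric]
      by (rule arg_cong[of _ _ "\<lambda>u. u / _"], rule sum_diff[symmetric]) (auto simp: peaks_def)
    then show ?thesis by (simp add: sum_divide_distrib)
  qed
  have "(\<Sum>z\<in>Zn n. cmod (D z))\<^sup>2 \<le> n * (\<Sum>z\<in>Zn n. (cmod (D z))\<^sup>2)"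
    using sum_squared_le_sum_of_squares[of "\<lambda>z. cmod (D z)" "Zn n"] assms
    by (simp add: mult.commute)
  also have "(\<Sum>z\<in>Zn n. (cmod (D z))\<^sup>2) = n * (\<Sum>j\<in>Zn n - ?J. (cmod (lam n a b c j ^ k / n))\<^sup>2)"
    unfolding parseval[OF assms Diff_subset, symmetric] by (simp add: D)
  also have "n * \<dots> = (\<Sum>j\<in>Zn n - ?J. ((cmod (lam n a b c j))\<^sup>2) ^ k)"
    using assms by (simp add: sum_distrib_left norm_divide norm_power power_divide power2_eq_square power_mult_distrib)
  also have "\<dots> \<le> (\<Sum>j\<in>Zn n - ?J. exp (- (real k * decay n (b - a) (c - a) j)))"
  proof (rule sum_mono)
    fix j
    have "(cmod (lam n a b c j))\<^sup>2 \<le> exp (- decay n (b - a) (c - a) j)"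
      using norm_lam_le[of n a b c j] exp_ge_add_one_self[of "- decay n (b - a) (c - a) j"] by linarith
    then have "((cmod (lam n a b c j))\<^sup>2) ^ k \<le> exp (- decay n (b - a) (c - a) j) ^ k"
      by (intro power_mono) auto
    then show "((cmod (lam n a b c j))\<^sup>2) ^ k \<le> exp (- (real k * decay n (b - a) (c - a) j))"
      by (simp add: exp_of_nat_mult[symmetric])
  qed
  finally show ?thesis by (simp add: D_def)
qed

section \<open>Averages of the Fourier tail\<close>

text \<open>
  The sine is concave on this interval, hence lies above its chord.
\<close>

lemma sin_ge_linear:
  assumes "0 \<le> x" "x \<le> pi / 2"
  shows "2 * x / pi \<le> sin x"
proof -
  have "convex_on {0..pi/2} (\<lambda>x. - sin x)"
  proof (rule f''_ge0_imp_convex[where f' = "\<lambda>x. - cos x" and f'' = sin])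
    show "0 \<le> sin x" if "x \<in> {0..pi/2}" for x
      using that pi_gt_zero by (intro sin_ge_zero) auto
  qed (auto intro!: derivative_eq_intros)
  from convex_onD[OF this, of "2 * x / pi" 0 "pi / 2"]
  show ?thesis using assms by (simp add: field_simps)
qed

lemma exp_le_inverse: "0 \<le> x \<Longrightarrow> exp (- x) \<le> 1 / (1 + x :: real)"
  using exp_ge_add_one_self[of x] by (simp add: exp_minus field_simps)

lemma inverse_squares_tail:
  assumes "M \<ge> 1"
  shows "(\<Sum>s=Suc M..N. 1 / real s ^ 2) \<le> 1 / real M"
proof (cases "M \<le> N")
  case True
  then have "(\<Sum>s=Suc M..N. 1 / real s ^ 2) \<le> 1 / real M - 1 / real N"
  proof (induction N rule: dec_induct)
    case (step N)
    have "1 / real (Suc N) ^ 2 \<le> 1 / (real N * real (Suc N))"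
      using step(1) assms by (intro divide_left_mono) (auto simp: power2_eq_square intro!: mult_right_mono)
    also have "\<dots> = 1 / real N - 1 / real (Suc N)"
      using step(1) assms by (simp add: field_simps)
    finally show ?case using step by simp
  qed simp
  then show ?thesis using divide_nonneg_nonneg[of 1 "real N"] by linarith
qed simp

text \<open>
  This bound is the better one for large \<open>u\<close> and the next one for small \<open>u\<close>. A quadratic expression in
  the sum is needed below to be \<open>O(1/u)\<close> over the whole range, which takes both.
\<close>

lemma gaussian_sum_le_inverse:
  fixes u :: real
  assumes "u > 0"
  shows "(\<Sum>s=1..N. exp (- (u * real s ^ 2))) \<le> 2 / u"
proof -
  have "(\<Sum>s=1..N. exp (- (u * real s ^ 2))) \<le> (\<Sum>s=1..N. (1 / u) * (1 / real s ^ 2))"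
  proof (rule sum_mono)
    fix s assume "s \<in> {1..N}"
    then have pos: "u * real s ^ 2 > 0" using assms by simp
    then have "exp (- (u * real s ^ 2)) \<le> 1 / (1 + u * real s ^ 2)"
      by (intro exp_le_inverse) simp
    also have "\<dots> \<le> 1 / (u * real s ^ 2)"
      using pos by (intro divide_left_mono) auto
    finally show "exp (- (u * real s ^ 2)) \<le> (1 / u) * (1 / real s ^ 2)" by simp
  qed
  also have "\<dots> = (1 / u) * (\<Sum>s=1..N. 1 / real s ^ 2)" by (simp only: sum_distrib_left)
  also have "(\<Sum>s=1..N. 1 / real s ^ 2) \<le> 2"
  proof (cases "N \<ge> 1")
    case True
    then show ?thesis
      using inverse_squares_tail[of 1 N] by (subst sum.atLeast_Suc_atMost) simp_all
  qed simp
  finally show ?thesis using assms by (simp add: divide_right_mono)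
qed

text \<open>
  The summand is at most \<open>2/(1 + v s)\<^sup>2\<close>, which is dominated by a telescoping series.
\<close>

lemma gaussian_sum_le_inverse_sqrt:
  fixes v :: real
  assumes "v > 0"
  shows "(\<Sum>s=1..N. exp (- (v\<^sup>2 * real s ^ 2))) \<le> 2 / v"
proof -
  have "(\<Sum>s=1..N. exp (- (v\<^sup>2 * real s ^ 2))) \<le> 2 / v * (1 - 1 / (1 + v * real N))"
  proof (induction N)
    case (Suc N)
    let ?p = "1 + v * real N" and ?q = "1 + v * real (Suc N)"
    have pos: "?p > 0" "?q > 0" using assms by (auto intro: add_pos_nonneg)
    have "exp (- (v\<^sup>2 * real (Suc N) ^ 2)) \<le> 1 / (1 + v\<^sup>2 * real (Suc N) ^ 2)"
      by (intro exp_le_inverse) simp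
    also have "\<dots> \<le> 2 / (?p * ?q)"
    proof -
      have "?p * ?q \<le> ?q * ?q" using pos assms by (intro mult_right_mono) auto
      also have "\<dots> \<le> 2 * (1 + v\<^sup>2 * real (Suc N) ^ 2)"
        using zero_le_power2[of "1 - v * real (Suc N)"]
        unfolding power_mult_distrib[symmetric] by (simp only: power2_eq_square algebra_simps)
      finally show ?thesis
        using pos by (simp add: divide_simps add_pos_nonneg)
    qed
    also have "\<dots> = 2 / v * (1 / ?p - 1 / ?q)"
    proof -
      have "1 / ?p - 1 / ?q = v / (?p * ?q)"
        using pos by (simp add: diff_frac_eq) (simp add: algebra_simps)
      then show ?thesis using assms by simp
    qed
    finally have "exp (- (v\<^sup>2 * real (Suc N) ^ 2)) \<le> 2 / v * (1 / ?p - 1 / ?q)" .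
    then show ?case using Suc.IH by (simp add: algebra_simps)
  qed simp
  also have "\<dots> \<le> 2 / v * 1"
    using assms by (intro mult_left_mono) (auto intro: add_nonneg_nonneg)
  finally show ?thesis by simp
qed

text \<open>
  One of the two factors of \<open>exp(-t w\<^sub>j)\<close>: the damping at \<open>x\<close> and \<open>y\<close> is the product of
  these expressions at \<open>j x\<close> and \<open>j y\<close>.
\<close>

definition damp :: "real \<Rightarrow> nat \<Rightarrow> int \<Rightarrow> real" where
  "damp t n y = exp (- (t * (sin (pi * of_int y / n))\<^sup>2 / 2))"

lemma damp_bound:
  assumes "0 < s" "s < int m" "t > 0"
  defines "u \<equiv> 2 * t / real m ^ 2"
  shows "damp t m s \<le> exp (- (u * real (nat s) ^ 2)) + exp (- (u * real (m - nat s) ^ 2))"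
proof -
  have gen: "damp t m s \<le> exp (- (u * r ^ 2))"
    if r: "0 \<le> r" "r \<le> real m / 2" and sn: "sin (pi * of_int s / m) = sin (pi * r / m)" for r
  proof -
    have m: "real m > 0" using assms by simp
    have "2 * r / m \<le> sin (pi * r / m)"
      using sin_ge_linear[of "pi * r / m"] r m by (simp add: field_simps)
    then have "(2 * r / m)\<^sup>2 \<le> (sin (pi * r / m))\<^sup>2"
      using r by (intro power_mono) auto
    then have "t * (2 * r / m)\<^sup>2 / 2 \<le> t * (sin (pi * r / m))\<^sup>2 / 2"
      using assms(3) by (intro divide_right_mono mult_left_mono) auto
    then show ?thesis unfolding damp_def sn u_def
      by (simp add: power_mult_distrib power_divide)
  qed
  show ?thesis
  proof (cases "real_of_int s \<le> real m / 2")
    case True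
    then show ?thesis using gen[of "real (nat s)"] assms(1)
      by (simp add: add_increasing2)
  next
    case False
    have "sin (pi * (real m - of_int s) / m) = sin (pi - pi * of_int s / m)"
      using assms by (simp add: right_diff_distrib diff_divide_distrib)
    then have "sin (pi * of_int s / m) = sin (pi * (real m - of_int s) / m)" by simp
    moreover have "real (m - nat s) = real m - of_int s" using assms by linarith
    ultimately show ?thesis using gen[of "real (m - nat s)"] False assms(1,2)
      by (simp add: add_increasing)
  qed
qed

text \<open>
  The term \<open>s = 0\<close> accounts for the \<open>1\<close>; the others are controlled by Gaussian sums with parameter
  \<open>u = 2t/m\<^sup>2\<close>, after folding the interval at \<open>m/2\<close>.
\<close>

lemma damp_sum_bound:
  assumes "m > 0" "t > 0"
  shows "(\<Sum>s\<in>Zn m. damp t m s)\<^sup>2 - 1 \<le> 12 * real m ^ 2 / t"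
proof -
  define u where "u = 2 * t / real m ^ 2"
  have u: "u > 0" using assms by (simp add: u_def)
  define G where "G = (\<Sum>s=1..m. exp (- (u * real s ^ 2)))"
  have "(\<Sum>s\<in>Zn m. damp t m s) = damp t m 0 + (\<Sum>s\<in>Zn m - {0}. damp t m s)"
    using assms by (subst sum.remove[of _ 0]) auto
  also have "(\<Sum>s\<in>Zn m - {0}. damp t m s)
      \<le> (\<Sum>s\<in>Zn m - {0}. exp (- (u * real (nat s) ^ 2)) + exp (- (u * real (m - nat s) ^ 2)))"
    unfolding u_def by (rule sum_mono) (rule damp_bound, use assms in auto)
  also have "\<dots> = (\<Sum>s\<in>{1..<m}. exp (- (u * real s ^ 2))) + (\<Sum>s\<in>{1..<m}. exp (- (u * real (m - s) ^ 2)))"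
    unfolding sum.distrib
    by (intro arg_cong2[of _ _ _ _ "(+)"]; rule sum.reindex_bij_witness[of _ int nat]) auto
  also have "(\<Sum>s\<in>{1..<m}. exp (- (u * real (m - s) ^ 2))) = (\<Sum>s\<in>{1..<m}. exp (- (u * real s ^ 2)))"
    by (rule sum.reindex_bij_witness[of _ "\<lambda>s. m - s" "\<lambda>s. m - s"]) auto
  also have "(\<Sum>s\<in>{1..<m}. exp (- (u * real s ^ 2))) \<le> G"
    unfolding G_def by (rule sum_mono2) auto
  finally have T: "(\<Sum>s\<in>Zn m. damp t m s) \<le> 1 + 2 * G" by (simp add: damp_def)
  have G0: "G \<ge> 0" unfolding G_def by (rule sum_nonneg) simp
  have G1: "G \<le> 2 / u" unfolding G_def by (rule gaussian_sum_le_inverse[OF u])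
  have "G \<le> 2 / sqrt u"
    using gaussian_sum_le_inverse_sqrt[of "sqrt u" m] u by (simp add: G_def)
  then have "G\<^sup>2 \<le> (2 / sqrt u)\<^sup>2" using G0 by (rule power_mono)
  then have G2: "G\<^sup>2 \<le> 4 / u" using u by (simp add: power_divide)
  have "(\<Sum>s\<in>Zn m. damp t m s)\<^sup>2 \<le> (1 + 2 * G)\<^sup>2"
    using T by (intro power_mono sum_nonneg) (auto simp: damp_def)
  also have "\<dots> = 1 + 4 * G + 4 * G\<^sup>2" by (simp add: power2_eq_square algebra_simps)
  also have "\<dots> \<le> 1 + 24 / u" using G1 G2 by (simp add: field_simps)
  finally show ?thesis using assms by (simp add: u_def)
qed

text \<open>
  Multiplication by \<open>j\<close> maps \<open>\<int>/n\<close> onto the multiples of \<open>d = gcd(j, n)\<close>, and each of them is hit \<open>d\<close> times.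
\<close>

lemma sum_multiples_mod:
  fixes F :: "int \<Rightarrow> real" and j :: int
  assumes "n > 0"
  defines "d \<equiv> nat (gcd j (int n))"
  shows "(\<Sum>x\<in>Zn n. F ((j * x) mod int n)) = d * (\<Sum>s\<in>Zn (n div d). F (int d * s))"
proof -
  define m where "m = n div d"
  have d0: "d > 0" using assms by (simp add: d_def)
  have dn: "int d dvd int n" and dj: "int d dvd j" by (simp_all add: d_def)
  have n: "n = d * m" using dn unfolding m_def int_dvd_int_iff by simp
  obtain j' where j: "j = int d * j'" using dj by auto
  have m0: "m > 0" using n assms(1) by simp
  have "gcd j (int n) = int d" by (simp add: d_def)
  then have "int d * gcd j' (int m) = int d" unfolding j n of_nat_mult gcd_mult_distrib_int[symmetric] 
    by (simp add: gcd_mult_left)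
  then have cop: "coprime j' (int m)" using d0 by (simp add: coprime_iff_gcd_eq_1)
  \<comment> \<open>Write \<open>x = m q + r\<close>; the residue of \<open>j x\<close> depends on \<open>r\<close> only.\<close>
  have "(\<Sum>x\<in>Zn n. F ((j * x) mod int n)) = (\<Sum>(q, r)\<in>Zn d \<times> Zn m. F (int d * ((j' * r) mod int m)))"
  proof (rule sum.reindex_bij_witness[of _ "\<lambda>(q, r). int m * q + r" "\<lambda>x. (x div int m, x mod int m)"])
    fix x assume x: "x \<in> Zn n"
    then show "(case (x div int m, x mod int m) of (q, r) \<Rightarrow> int m * q + r) = x" by simp
    have "x div int m < int d"
    proof (rule ccontr)
      assume "\<not> x div int m < int d"
      then have "int m * int d \<le> int m * (x div int m)" by (intro mult_left_mono) auto
      also have "\<dots> \<le> x" using m0 mult_div_mod_eq[of "int m" x] pos_mod_sign[of "int m" x] by linarith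
      finally show False using x by (simp add: n mult.commute)
    qed
    then show "(x div int m, x mod int m) \<in> Zn d \<times> Zn m"
      using x m0 by (simp add: pos_imp_zdiv_nonneg_iff)
    have "(j * x) mod int n = int d * ((j' * (x mod int m)) mod int m)"
      unfolding j n of_nat_mult mult.assoc by (simp add: mod_mult_right_eq)
    then show "(case (x div int m, x mod int m) of (q, r) \<Rightarrow> F (int d * ((j' * r) mod int m))) = F ((j * x) mod int n)"
      by simp
  next
    fix b assume b: "b \<in> Zn d \<times> Zn m"
    obtain q r where qr: "b = (q, r)" by (cases b)
    then have r: "0 \<le> q" "q < int d" "0 \<le> r" "r < int m" using b by auto
    then show "((case b of (q, r) \<Rightarrow> int m * q + r) div int m, (case b of (q, r) \<Rightarrow> int m * q + r) mod int m) = b"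
      by (simp add: qr)
    have "int m * q + r < int m * (q + 1)" using r by (simp add: algebra_simps)
    also have "\<dots> \<le> int m * int d" using r by (intro mult_left_mono) auto
    finally show "(case b of (q, r) \<Rightarrow> int m * q + r) \<in> Zn n" using r by (simp add: qr n mult.commute)
  qed
  also have "\<dots> = d * (\<Sum>r\<in>Zn m. F (int d * ((j' * r) mod int m)))"
    by (simp add: sum.cartesian_product[symmetric])
  also have "(\<Sum>r\<in>Zn m. F (int d * ((j' * r) mod int m))) = (\<Sum>s\<in>Zn m. F (int d * s))"
  proof -
    have inj: "inj_on (\<lambda>r. (j' * r) mod int m) (Zn m)"
    proof
      fix r s assume "r \<in> Zn m" "s \<in> Zn m" "(j' * r) mod int m = (j' * s) mod int m"
      moreover from this have "[r = s] (mod int m)"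
        using cop by (simp add: cong_mult_lcancel flip: cong_def)
      ultimately show "r = s" by (simp add: cong_def)
    qed
    have "(\<lambda>r. (j' * r) mod int m) ` Zn m = Zn m"
      by (rule endo_inj_surj[OF _ _ inj]) (use m0 in auto)
    then show ?thesis
      using sum.reindex[OF inj, of "\<lambda>s. F (int d * s)"] by (simp add: o_def)
  qed
  finally show ?thesis by (simp add: m_def)
qed

lemma sin_squared_cong:
  assumes "n > 0" "[y = y'] (mod int n)"
  shows "(sin (pi * of_int y / real n))\<^sup>2 = (sin (pi * of_int y' / real n))\<^sup>2"
proof -
  obtain k where "y - y' = int n * k" using assms(2) by (auto simp: cong_iff_dvd_diff)
  then have "real_of_int y = real_of_int y' + real n * of_int k"
    by (metis add.commute diff_add_cancel of_int_add of_int_mult of_int_of_nat_eq)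
  then have y: "pi * of_int y / real n = pi * of_int y' / real n + of_int k * pi"
    using assms(1) by (simp add: field_simps)
  have sin0: "sin (of_int k * pi) = 0" by (simp add: sin_zero_iff_int2)
  then have "(cos (of_int k * pi))\<^sup>2 = 1"
    using sin_cos_squared_add[of "of_int k * pi"] by simp
  with sin0 show ?thesis unfolding y by (simp add: sin_add power_mult_distrib)
qed

lemma damp_periodic: "n > 0 \<Longrightarrow> damp t n (y mod int n) = damp t n y"
  using sin_squared_cong[of n "y mod int n" y] by (simp add: damp_def)

lemma decay_cong:
  assumes "n > 0" "[x = x'] (mod int n)" "[y = y'] (mod int n)"
  shows "decay n x y j = decay n x' y' j"
  using sin_squared_cong[OF assms(1) cong_mult[OF cong_refl assms(2)], of j]
    sin_squared_cong[OF assms(1) cong_mult[OF cong_refl assms(3)], of j]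
  by (simp add: decay_def)

lemma peaks_cong:
  assumes "n > 0" "[x = x'] (mod int n)" "[y = y'] (mod int n)"
  shows "peaks n x y = peaks n x' y'"
  using decay_cong[OF assms] by (simp add: peaks_def flip: decay_eq_0_iff[OF assms(1)])

lemma sum_count_peaks:
  fixes j :: int
  assumes "n > 0"
  shows "(\<Sum>x\<in>Zn n. if int n dvd j * x then 1 else 0 :: real) = nat (gcd j (int n))"
proof -
  define d where "d = nat (gcd j (int n))"
  have d: "d > 0" unfolding d_def zero_less_nat_eq gcd_pos_int using assms by simp
  have "int d dvd int n" by (simp add: d_def)
  then obtain m where n: "n = d * m" unfolding int_dvd_int_iff by (elim dvdE)
  have m: "n div d = m" using d(1) by (subst n) (rule nonzero_mult_div_cancel_left, simp)
  have "m > 0" using n assms by (cases m) auto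
  have "(\<Sum>x\<in>Zn n. if int n dvd j * x then 1 else 0 :: real)
      = d * (\<Sum>s\<in>Zn (n div d). if int n dvd int d * s then 1 else 0 :: real)"
    using sum_multiples_mod[OF assms, of "\<lambda>y. if int n dvd y then 1 else 0" j, folded d_def]
    by (simp only: dvd_mod_iff dvd_refl)
  also have "(\<Sum>s\<in>Zn (n div d). if int n dvd int d * s then 1 else 0 :: real) = (\<Sum>s\<in>Zn m. if s = 0 then 1 else 0)"
    unfolding m
  proof (rule sum.cong[OF refl])
    fix s assume s: "s \<in> Zn m"
    have "int n dvd int d * s \<longleftrightarrow> int m dvd s"
      using d(1) by (subst n) simp
    also have "\<dots> \<longleftrightarrow> s = 0" using s by (auto dest: zdvd_imp_le)
    finally show "(if int n dvd int d * s then 1 else 0 :: real) = (if s = 0 then 1 else 0)" by simp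
  qed
  finally show ?thesis using \<open>m > 0\<close> by (simp add: d_def)
qed

text \<open>
  With \<open>n = d m\<close>, the sum is \<open>d\<^sup>2\<close> times the square of a sum over \<open>\<int>/m\<close>, and the pairs that are left out
  remove exactly \<open>d\<^sup>2\<close>. The resulting bound \<open>d\<^sup>2 * 12 m\<^sup>2/t\<close> is the same for every \<open>j\<close>, whatever
  the divisors of \<open>n\<close> are.
\<close>

lemma damp_sum_fixed_frequency:
  fixes j :: int
  assumes "n > 0" "t > 0"
  shows "(\<Sum>x\<in>Zn n. \<Sum>y\<in>Zn n. if decay n x y j = 0 then 0 else exp (- (t * decay n x y j)))
    \<le> 12 * real n ^ 2 / t"
proof -
  define d where "d = nat (gcd j (int n))"
  define m where "m = n div d"
  have d: "d > 0" unfolding d_def zero_less_nat_eq gcd_pos_int using assms by simp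
  have "int d dvd int n" by (simp add: d_def)
  then have n: "n = d * m" unfolding int_dvd_int_iff m_def by simp
  have m: "m > 0" using n assms by (cases m) auto
  have "(\<Sum>x\<in>Zn n. damp t n (j * x)) = (\<Sum>x\<in>Zn n. damp t n ((j * x) mod int n))"
    by (simp add: damp_periodic[OF assms(1)])
  also have "\<dots> = d * (\<Sum>s\<in>Zn m. damp t n (int d * s))"
    unfolding m_def d_def by (rule sum_multiples_mod[OF assms(1)])
  also have "(\<Sum>s\<in>Zn m. damp t n (int d * s)) = (\<Sum>s\<in>Zn m. damp t m s)"
  proof (rule sum.cong[OF refl])
    fix s
    have "real n = real d * real m" using n by (metis of_nat_mult)
    then have "pi * of_int (int d * s) / real n = pi * of_int s / real m" using d(1) by simp
    then show "damp t n (int d * s) = damp t m s" by (simp only: damp_def)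
  qed
  finally have sum: "(\<Sum>x\<in>Zn n. damp t n (j * x)) = d * (\<Sum>s\<in>Zn m. damp t m s)" .
  have split: "(if decay n x y j = 0 then 0 else exp (- (t * decay n x y j)))
     = damp t n (j * x) * damp t n (j * y)
       - (if int n dvd j * x then 1 else 0) * (if int n dvd j * y then 1 else 0)" for x y
  proof -
    have "damp t n (j * x) * damp t n (j * y) = exp (- (t * decay n x y j))"
      by (simp add: damp_def decay_def mult_exp_exp) (simp add: algebra_simps add_divide_distrib)
    then show ?thesis using decay_eq_0_iff[OF assms(1), of x y j] by auto
  qed
  have "(\<Sum>x\<in>Zn n. \<Sum>y\<in>Zn n. if decay n x y j = 0 then 0 else exp (- (t * decay n x y j)))
     = (\<Sum>x\<in>Zn n. damp t n (j * x))\<^sup>2 - (\<Sum>x\<in>Zn n. if int n dvd j * x then 1 else 0)\<^sup>2"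
    unfolding split sum_subtractf power2_eq_square sum_product ..
  also have "\<dots> = real d ^ 2 * ((\<Sum>s\<in>Zn m. damp t m s)\<^sup>2 - 1)"
    unfolding sum sum_count_peaks[OF assms(1)] d_def[symmetric] by (simp only: power_mult_distrib right_diff_distrib mult_1_right)
  also have "\<dots> \<le> real d ^ 2 * (12 * real m ^ 2 / t)"
    by (intro mult_left_mono damp_sum_bound m assms) simp
  also have "\<dots> = 12 * real n ^ 2 / t"
  proof -
    have "real n = real d * real m" using n by (metis of_nat_mult)
    then show ?thesis by (simp add: power_mult_distrib)
  qed
  finally show ?thesis .
qed

definition fourier_tail :: "nat \<Rightarrow> real \<Rightarrow> int \<Rightarrow> int \<Rightarrow> real" where
  "fourier_tail n t x y = (\<Sum>j\<in>Zn n - peaks n x y. exp (- (t * decay n x y j)))"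

lemma fourier_tail_cong:
  assumes "n > 0" "[x = x'] (mod int n)" "[y = y'] (mod int n)"
  shows "fourier_tail n t x y = fourier_tail n t x' y'"
  using decay_cong[OF assms] peaks_cong[OF assms] by (simp add: fourier_tail_def)

lemma fourier_tail_sum:
  assumes "n > 0" "t > 0"
  shows "(\<Sum>(x, y)\<in>Zn n \<times> Zn n. fourier_tail n t x y) \<le> 12 * real n ^ 3 / t"
proof -
  have tail: "fourier_tail n t x y = (\<Sum>j\<in>Zn n. if decay n x y j = 0 then 0 else exp (- (t * decay n x y j)))" for x y
    unfolding fourier_tail_def decay_eq_0_iff[OF assms(1)]
    by (rule sum.mono_neutral_cong_left) (auto simp: peaks_def)
  have "(\<Sum>(x, y)\<in>Zn n \<times> Zn n. fourier_tail n t x y)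
    = (\<Sum>x\<in>Zn n. \<Sum>j\<in>Zn n. \<Sum>y\<in>Zn n. if decay n x y j = 0 then 0 else exp (- (t * decay n x y j)))"
    unfolding sum.cartesian_product[symmetric] tail by (intro sum.cong[OF refl] sum.swap)
  also have "\<dots> = (\<Sum>j\<in>Zn n. \<Sum>x\<in>Zn n. \<Sum>y\<in>Zn n. if decay n x y j = 0 then 0 else exp (- (t * decay n x y j)))"
    by (rule sum.swap)
  also have "\<dots> \<le> (\<Sum>j\<in>Zn n. 12 * real n ^ 2 / t)"
    by (rule sum_mono) (rule damp_sum_fixed_frequency[OF assms])
  also have "\<dots> = 12 * real n ^ 3 / t" by (simp add: power3_eq_cube power2_eq_square)
  finally show ?thesis .
qed

text \<open>
  Markov's inequality, applied to the average of the tail over all pairs.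
\<close>

lemma card_large_fourier_tail:
  assumes "n > 0" "t > 0" "\<eta> > 0"
  shows "card {(x, y) \<in> Zn n \<times> Zn n. fourier_tail n t x y \<ge> \<eta>} \<le> 12 * real n ^ 3 / (t * \<eta>)"
proof -
  let ?S = "{(x, y) \<in> Zn n \<times> Zn n. fourier_tail n t x y \<ge> \<eta>}"
  have "card ?S * \<eta> = (\<Sum>p\<in>?S. \<eta>)" by simp
  also have "\<dots> \<le> (\<Sum>(x, y)\<in>?S. fourier_tail n t x y)" by (rule sum_mono) auto
  also have "\<dots> \<le> (\<Sum>(x, y)\<in>Zn n \<times> Zn n. fourier_tail n t x y)"
    by (rule sum_mono2) (auto simp: fourier_tail_def intro: sum_nonneg)
  also have "\<dots> \<le> 12 * real n ^ 3 / t" by (rule fourier_tail_sum[OF assms(1,2)])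
  finally show ?thesis using assms by (simp add: field_simps)
qed

text \<open>
  If \<open>j x\<close>, \<open>j y\<close> and \<open>j n\<close> are multiples of \<open>n\<close>, then so is \<open>j g\<close> for \<open>g = gcd(x, y, n)\<close>, and
  \<open>j\<close> is a multiple of \<open>n/g\<close>.
\<close>

lemma card_peaks_le_gcd:
  assumes "n > 0"
  shows "int (card (peaks n x y)) \<le> gcd (gcd x y) (int n)"
proof -
  define g where "g = gcd (gcd x y) (int n)"
  have g: "g > 0" "g dvd int n" using assms by (auto simp: g_def)
  then obtain m where n: "int n = g * m" by auto
  have m: "m > 0" using n g assms by (metis of_nat_0_less_iff zero_less_mult_pos)
  have "peaks n x y \<subseteq> (\<lambda>i. m * i) ` {0..<g}"
  proof
    fix j assume j: "j \<in> peaks n x y"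
    then have "int n dvd gcd (j * x) (j * y)" by (auto simp: peaks_def)
    then have "int n dvd j * gcd x y"
      unfolding gcd_mult_distrib_int[symmetric] by (metis abs_mult abs_gcd_int dvd_abs_iff)
    then have "int n dvd gcd (j * gcd x y) (j * int n)" by simp
    then have "int n dvd \<bar>j\<bar> * g" unfolding gcd_mult_distrib_int[symmetric] g_def .
    then have "m dvd \<bar>j\<bar>" using g(1) unfolding n by (simp add: mult.commute)
    then obtain i where i: "j = m * i" by auto
    have "0 \<le> m * i" "m * i < m * g" using j n by (auto simp: peaks_def i mult.commute)
    then have "i \<in> {0..<g}" using m by (auto simp: zero_le_mult_iff)
    then show "j \<in> (\<lambda>i. m * i) ` {0..<g}" using i by auto
  qed
  then have "card (peaks n x y) \<le> card {0..<g}"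
    by (rule surj_card_le[rotated]) simp
  then have "int (card (peaks n x y)) \<le> g" using g(1) by simp
  then show ?thesis by (simp only: g_def)
qed

text \<open>
  More than \<open>D\<close> peaks force \<open>x\<close> and \<open>y\<close> to share a divisor \<open>d > D\<close> of \<open>n\<close>, and only \<open>(n/d)\<^sup>2\<close> pairs do.
\<close>

lemma card_many_peaks:
  assumes "n > 0" "D \<ge> 1"
  shows "card {(x, y) \<in> Zn n \<times> Zn n. card (peaks n x y) > D} \<le> real n ^ 2 / D"
proof -
  define M where "M d = {x \<in> Zn n. int d dvd x}" for d
  have finM: "finite (M d)" for d
    by (rule finite_subset[of _ "Zn n"]) (auto simp: M_def)
  let ?Q = "{d \<in> {Suc D..n}. d dvd n}"
  have cardM: "real (card (M d)) \<le> real n / d" if d: "d \<in> ?Q" for d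
  proof -
    obtain m where m: "n = d * m" using d by auto
    have "M d \<subseteq> (\<lambda>i. int d * i) ` Zn m"
    proof
      fix x assume x: "x \<in> M d"
      then obtain i where i: "x = int d * i" by (auto simp: M_def)
      then have "0 \<le> int d * i" "int d * i < int d * int m" using x m by (auto simp: M_def)
      then have "i \<in> Zn m" using d by (auto simp: zero_le_mult_iff)
      then show "x \<in> (\<lambda>i. int d * i) ` Zn m" using i by auto
    qed
    then have "card (M d) \<le> card (Zn m)" by (rule surj_card_le[rotated]) simp
    then show ?thesis using m d by simp
  qed
  have "{(x, y) \<in> Zn n \<times> Zn n. card (peaks n x y) > D} \<subseteq> (\<Union>d\<in>?Q. M d \<times> M d)"
  proof clarsimp
    fix x y assume xy: "0 \<le> x" "x < int n" "0 \<le> y" "y < int n" "D < card (peaks n x y)"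
    define g where "g = nat (gcd (gcd x y) (int n))"
    have "int g = gcd (gcd x y) (int n)" by (simp add: g_def)
    then have dv: "int g dvd x" "int g dvd y" "int g dvd int n"
      by (auto intro: dvd_trans[OF gcd_dvd1])
    then have "g dvd n" by simp
    moreover have "g \<ge> Suc D"
      using card_peaks_le_gcd[OF assms(1), of x y] xy(5) by (simp add: \<open>int g = _\<close>[symmetric])
    moreover have "g \<le> n" using \<open>g dvd n\<close> assms(1) by (rule dvd_imp_le)
    ultimately show "\<exists>d. Suc D \<le> d \<and> d \<le> n \<and> d dvd n \<and> x \<in> M d \<and> y \<in> M d"
      using dv xy by (intro exI[of _ g]) (auto simp: M_def)
  qed
  then have "card {(x, y) \<in> Zn n \<times> Zn n. card (peaks n x y) > D} \<le> card (\<Union>d\<in>?Q. M d \<times> M d)"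
    by (intro card_mono finite_UN_I finite_cartesian_product finM) simp_all
  also have "\<dots> \<le> (\<Sum>d\<in>?Q. card (M d \<times> M d))" by (rule card_UN_le) simp
  finally have "real (card {(x, y) \<in> Zn n \<times> Zn n. card (peaks n x y) > D}) \<le> (\<Sum>d\<in>?Q. real (card (M d)) * real (card (M d)))"
    by (simp add: card_cartesian_product flip: of_nat_mult of_nat_sum)
  also have "\<dots> \<le> (\<Sum>d\<in>?Q. (real n / d) * (real n / d))"
    by (intro sum_mono mult_mono cardM) auto
  also have "\<dots> \<le> (\<Sum>d=Suc D..n. (real n / d) * (real n / d))"
    by (rule sum_mono2) auto
  also have "\<dots> = real n ^ 2 * (\<Sum>d=Suc D..n. 1 / real d ^ 2)"
    by (simp add: sum_distrib_left power2_eq_square)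
  also have "\<dots> \<le> real n ^ 2 * (1 / D)"
    by (intro mult_left_mono inverse_squares_tail assms) auto
  finally show ?thesis by simp
qed

section \<open>Counting pairs of matrices by their invariants\<close>

lemma card_le_fibers:
  assumes "finite T" "f ` S \<subseteq> T" "\<And>t. t \<in> T \<Longrightarrow> finite {s \<in> S. f s = t} \<and> card {s \<in> S. f s = t} \<le> m"
  shows "card S \<le> m * card T"
proof -
  have "S = (\<Union>t\<in>T. {s \<in> S. f s = t})" using assms(2) by auto
  then have "card S \<le> (\<Sum>t\<in>T. card {s \<in> S. f s = t})"
    using card_UN_le[OF assms(1), of "\<lambda>t. {s \<in> S. f s = t}"] by simp
  also have "\<dots> \<le> m * card T"
    using sum_bounded_above[of T "\<lambda>t. card {s \<in> S. f s = t}" m] assms(3) by (simp add: mult.commute)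
  finally show ?thesis .
qed

lemma card_Sigma_le:
  assumes "finite X" "\<And>x. x \<in> X \<Longrightarrow> finite (Y x) \<and> card (Y x) \<le> m"
  shows "card (Sigma X Y) \<le> card X * m"
  using assms sum_bounded_above[of X "\<lambda>x. card (Y x)" m] by (simp add: card_SigmaI)

lemma Zn_eq_if_dvd:
  "x \<in> Zn n \<Longrightarrow> y \<in> Zn n \<Longrightarrow> int n dvd x - y \<Longrightarrow> x = y"
  by (simp add: mod_eq_dvd_iff[symmetric])

text \<open>
  Subtracting the values at two roots \<open>x \<noteq> r\<close> and dividing by \<open>x - r\<close> leaves a linear congruence for \<open>x\<close>.
\<close>

lemma card_quadratic_roots:
  assumes "prime p" "\<not> int p dvd A"
  shows "card {x \<in> Zn p. int p dvd A * x\<^sup>2 + B * x + C} \<le> 2"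
proof (cases "{x \<in> Zn p. int p dvd A * x\<^sup>2 + B * x + C} = {}")
  case False
  let ?S = "{x \<in> Zn p. int p dvd A * x\<^sup>2 + B * x + C}"
  obtain r where r: "r \<in> ?S" using False by blast
  have pr: "prime (int p)" using assms by simp
  have other: "int p dvd A * (x + r) + B" if "x \<in> ?S - {r}" for x
  proof -
    have "int p dvd (A * x\<^sup>2 + B * x + C) - (A * r\<^sup>2 + B * r + C)"
      using r that by (intro dvd_diff) auto
    also have "(A * x\<^sup>2 + B * x + C) - (A * r\<^sup>2 + B * r + C) = (x - r) * (A * (x + r) + B)"
      by (simp add: power2_eq_square algebra_simps)
    finally show ?thesis
      using that r Zn_eq_if_dvd[of x p r] by (auto simp: prime_dvd_mult_iff[OF pr])
  qed
  have "x = y" if xy: "x \<in> ?S - {r}" "y \<in> ?S - {r}" for x y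
  proof -
    have "int p dvd (A * (x + r) + B) - (A * (y + r) + B)"
      using xy by (intro dvd_diff other)
    also have "\<dots> = A * (x - y)" by (simp add: algebra_simps)
    finally show ?thesis
      using xy assms Zn_eq_if_dvd[of x p y] by (auto simp: prime_dvd_mult_iff[OF pr])
  qed
  moreover have "finite (?S - {r})" by (rule finite_subset[of _ "Zn p"]) auto
  ultimately have "card (?S - {r}) \<le> Suc 0" by (subst card_le_Suc0_iff_eq) auto
  then show ?thesis using r by (simp add: card_Diff_singleton)
qed (simp only: card.empty)

abbreviation "vec3 p \<equiv> Zn p \<times> Zn p \<times> Zn p"

definition mat_of :: "nat \<Rightarrow> int \<times> int \<times> int \<Rightarrow> mat2" where
  "mat_of p = (\<lambda>(a, b, c). mat_mod p (traceless a b c))"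

text \<open>
  This is \<open>2 tr(XY)\<close> in the coordinates of traceless matrices, so that \<open>\<alpha>\<close>, \<open>\<beta>\<close> and \<open>\<gamma>\<close> are its values at
  \<open>(P, Q)\<close>, \<open>(P, P)\<close> and \<open>(Q, Q)\<close>.
\<close>

definition form :: "nat \<Rightarrow> int \<times> int \<times> int \<Rightarrow> int \<times> int \<times> int \<Rightarrow> int" where
  "form p = (\<lambda>(a, b, c) (x, y, z). 2 * (2 * a * x + b * z + c * y) mod int p)"

lemma form_eq_tr: "2 * tr p (mat_of p P ** mat_of p Q) mod int p = form p P Q"
  by (cases P; cases Q) (simp add: mat_of_def form_def tr_traceless mod_simps)

lemma bij_mat_of: "p > 0 \<Longrightarrow> bij_betw (mat_of p) (vec3 p) (sl2 p)"
  unfolding bij_betw_def sl2_eq_traceless mat_of_def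
  by (auto simp: inj_on_def mat_mod_traceless_eq_iff)

lemma form_in_Zn: "p > 0 \<Longrightarrow> form p P Q \<in> Zn p"
  by (auto simp: form_def split: prod.splits)

lemma form_eqD: "form p (a, b, c) (x, y, z) = w \<Longrightarrow> int p dvd 2 * (2 * a * x + b * z + c * y) - w"
  by (auto simp: form_def minus_mod_eq_mult_div)

lemma not_dvd_Zn: "b \<in> Zn p \<Longrightarrow> b \<noteq> 0 \<Longrightarrow> \<not> int p dvd b"
  by (auto dest: zdvd_imp_le)

locale odd_prime =
  fixes p :: nat
  assumes pr: "prime p" and odd: "odd p"
begin

lemma prime_int: "prime (int p)" using pr by simp

lemma p_pos: "p > 0" using pr by (rule prime_gt_0_nat)

lemma not_dvd_2: "\<not> int p dvd 2"
proof
  assume "int p dvd 2"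
  then have "int p \<le> 2" by (rule zdvd_imp_le) simp
  then show False using prime_ge_2_nat[OF pr] odd by (cases "p = 2") auto
qed

text \<open>
  Once the off-diagonal entries are chosen, the diagonal entry solves a quadratic equation.
\<close>

lemma card_sphere: "card {P \<in> vec3 p. form p P P = u} \<le> 2 * p\<^sup>2"
proof -
  have "card {P \<in> vec3 p. form p P P = u} \<le> 2 * card (Zn p \<times> Zn p)"
  proof (rule card_le_fibers[where f = snd])
    fix bc assume "bc \<in> Zn p \<times> Zn p"
    obtain b c where bc: "bc = (b, c)" by (cases bc)
    let ?S = "{P \<in> {P \<in> vec3 p. form p P P = u}. snd P = bc}"
    let ?R = "{a \<in> Zn p. int p dvd 4 * a\<^sup>2 + 0 * a + (4 * b * c - u)}"
    have inj: "inj_on fst ?S" by (auto simp: inj_on_def bc)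
    have sub: "fst ` ?S \<subseteq> ?R"
    proof
      fix a assume "a \<in> fst ` ?S"
      then have "a \<in> Zn p" "form p (a, b, c) (a, b, c) = u" by (auto simp: bc)
      then show "a \<in> ?R"
        using form_eqD[of p a b c a b c u] by (simp add: power2_eq_square algebra_simps)
    qed
    have "\<not> int p dvd 4"
      using prime_dvd_mult_iff[OF prime_int, of 2 2] not_dvd_2 by simp
    then have "card ?R \<le> 2" by (rule card_quadratic_roots[OF pr])
    moreover have "card ?S \<le> card ?R"
      by (rule card_inj_on_le[OF inj sub]) (rule finite_subset[of _ "Zn p"], auto)
    moreover have "finite ?S" by (rule finite_subset[of _ "vec3 p"]) auto
    ultimately show "finite ?S \<and> card ?S \<le> 2" by linarith
  qed auto
  then show ?thesis by (simp add: card_cartesian_product power2_eq_square)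
qed

lemma card_plane:
  assumes "b \<in> Zn p" "b \<noteq> 0"
  shows "card {Q \<in> vec3 p. form p (a, b, c) Q = w} \<le> p\<^sup>2"
proof -
  have "inj_on (\<lambda>(x, y, z). (x, y)) {Q \<in> vec3 p. form p (a, b, c) Q = w}"
  proof (clarsimp simp: inj_on_def)
    fix x y z z' assume z: "0 \<le> z" "z < int p" "0 \<le> z'" "z' < int p"
      and w: "form p (a, b, c) (x, y, z') = form p (a, b, c) (x, y, z)"
    have "int p dvd (2 * (2 * a * x + b * z + c * y) - form p (a, b, c) (x, y, z))
        - (2 * (2 * a * x + b * z' + c * y) - form p (a, b, c) (x, y, z))"
      by (intro dvd_diff form_eqD refl w)
    then have "int p dvd 2 * (b * (z - z'))" by (simp add: algebra_simps)
    then show "z = z'"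
      using not_dvd_2 not_dvd_Zn[OF assms] Zn_eq_if_dvd[of z p z'] z
      by (simp add: prime_dvd_mult_iff[OF prime_int])
  qed
  moreover have "(\<lambda>(x, y, z). (x, y)) ` {Q \<in> vec3 p. form p (a, b, c) Q = w} \<subseteq> Zn p \<times> Zn p" by auto
  ultimately have "card {Q \<in> vec3 p. form p (a, b, c) Q = w} \<le> card (Zn p \<times> Zn p)"
    by (rule card_inj_on_le) simp
  then show ?thesis by (simp add: card_cartesian_product power2_eq_square)
qed

text \<open>
  As \<open>b \<noteq> 0\<close>, the linear equation determines \<open>z\<close> from \<open>x\<close> and \<open>y\<close>. Substituting it into the quadratic
  one gives, for each \<open>y\<close>, a quadratic equation for \<open>x\<close> with leading coefficient \<open>8 b\<close>.
\<close>

lemma card_plane_sphere: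
  assumes "b \<in> Zn p" "b \<noteq> 0"
  shows "card {Q \<in> vec3 p. form p (a, b, c) Q = w \<and> form p Q Q = v} \<le> 2 * p"
proof -
  have "card {Q \<in> vec3 p. form p (a, b, c) Q = w \<and> form p Q Q = v} \<le> 2 * card (Zn p)"
  proof (rule card_le_fibers[where f = "fst \<circ> snd"])
    fix y assume "y \<in> Zn p"
    let ?S = "{Q \<in> {Q \<in> vec3 p. form p (a, b, c) Q = w \<and> form p Q Q = v}. (fst \<circ> snd) Q = y}"
    let ?R = "{x \<in> Zn p. int p dvd (8 * b) * x\<^sup>2 + (- 16 * a * y) * x + (4 * y * w - 8 * c * y\<^sup>2 - 2 * b * v)}"
    have inj: "inj_on fst ?S"
    proof (clarsimp simp: inj_on_def)
      fix x z z' assume z: "0 \<le> z" "z < int p" "0 \<le> z'" "z' < int p"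
        and w: "form p (a, b, c) (x, y, z') = form p (a, b, c) (x, y, z)"
      have "int p dvd (2 * (2 * a * x + b * z + c * y) - form p (a, b, c) (x, y, z))
          - (2 * (2 * a * x + b * z' + c * y) - form p (a, b, c) (x, y, z))"
        by (intro dvd_diff form_eqD refl w)
      then have "int p dvd 2 * (b * (z - z'))" by (simp add: algebra_simps)
      then show "z = z'"
        using not_dvd_2 not_dvd_Zn[OF assms] Zn_eq_if_dvd[of z p z'] z
        by (simp add: prime_dvd_mult_iff[OF prime_int])
    qed
    have sub: "fst ` ?S \<subseteq> ?R"
    proof
      fix x assume "x \<in> fst ` ?S"
      then obtain z where x: "x \<in> Zn p" and w: "form p (a, b, c) (x, y, z) = w"
        and v: "form p (x, y, z) (x, y, z) = v" by auto
      \<comment> \<open>This combination eliminates \<open>z\<close>.\<close>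
      have "int p dvd 2 * b * (2 * (2 * x * x + y * z + z * y) - v)
          - 4 * y * (2 * (2 * a * x + b * z + c * y) - w)"
        by (intro dvd_diff dvd_mult form_eqD w v)
      also have "\<dots> = (8 * b) * x\<^sup>2 + (- 16 * a * y) * x + (4 * y * w - 8 * c * y\<^sup>2 - 2 * b * v)"
        by (simp add: power2_eq_square algebra_simps)
      finally show "x \<in> ?R" using x by blast
    qed
    have "\<not> int p dvd 2 * (2 * (2 * b))"
      using not_dvd_2 not_dvd_Zn[OF assms] by (simp only: prime_dvd_mult_iff[OF prime_int]) auto
    then have "card ?R \<le> 2"
      by (intro card_quadratic_roots[OF pr]) simp
    moreover have "card ?S \<le> card ?R"
      by (rule card_inj_on_le[OF inj sub]) (rule finite_subset[of _ "Zn p"], auto)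
    moreover have "finite ?S" by (rule finite_subset[of _ "vec3 p"]) auto
    ultimately show "finite ?S \<and> card ?S \<le> 2" by linarith
  qed auto
  then show ?thesis by simp
qed

text \<open>
  The values of the three invariants confine \<open>P\<close> to a quadric, and then \<open>Q\<close> to the intersection of a
  quadric and a plane. As there are \<open>p\<^sup>6\<close> pairs in all, a triple of values together with \<open>b \<noteq> 0\<close> is at most
  \<open>4\<close> times as likely as the triple is under the uniform distribution on \<open>F\<^sub>p\<^sup>3\<close>; this transfers estimates for random residues to random matrices.
\<close>

lemma card_pairs_with_forms:
  assumes "T \<subseteq> Zn p \<times> Zn p \<times> Zn p"
  shows "card {(P, Q) \<in> vec3 p \<times> vec3 p. fst (snd P) \<noteq> 0 \<and> (form p P Q, form p P P, form p Q Q) \<in> T}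
    \<le> 4 * p ^ 3 * card T"
proof (rule card_le_fibers[where f = "\<lambda>(P, Q). (form p P Q, form p P P, form p Q Q)"])
  show "finite T" by (rule finite_subset[OF assms]) simp
  fix t assume "t \<in> T"
  obtain w u v where t: "t = (w, u, v)" by (cases t)
  let ?S = "{s \<in> {(P, Q) \<in> vec3 p \<times> vec3 p. fst (snd P) \<noteq> 0 \<and> (form p P Q, form p P P, form p Q Q) \<in> T}.
      (case s of (P, Q) \<Rightarrow> (form p P Q, form p P P, form p Q Q)) = t}"
  let ?X = "{P \<in> {P \<in> vec3 p. form p P P = u}. fst (snd P) \<noteq> 0}"
  let ?Y = "\<lambda>P. {Q \<in> vec3 p. form p P Q = w \<and> form p Q Q = v}"
  have fin: "finite (Sigma ?X ?Y)"
    by (rule finite_subset[of _ "vec3 p \<times> vec3 p"]) auto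
  have sub: "?S \<subseteq> Sigma ?X ?Y" by (auto simp: t)
  have "card ?S \<le> card (Sigma ?X ?Y)" by (rule card_mono[OF fin sub])
  also have "\<dots> \<le> card ?X * (2 * p)"
  proof (rule card_Sigma_le)
    show "finite ?X" by (rule finite_subset[of _ "vec3 p"]) auto
    fix P assume "P \<in> ?X"
    then show "finite (?Y P) \<and> card (?Y P) \<le> 2 * p"
      using card_plane_sphere[of "fst (snd P)" "fst P" "snd (snd P)" w v]
      by (auto intro: finite_subset[of _ "vec3 p"])
  qed
  also have "card ?X \<le> card {P \<in> vec3 p. form p P P = u}"
    by (rule card_mono) (auto intro: finite_subset[of _ "vec3 p"])
  also have "\<dots> \<le> 2 * p\<^sup>2" by (rule card_sphere)
  finally show "finite ?S \<and> card ?S \<le> 4 * p ^ 3"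
    using finite_subset[OF sub fin] by (simp add: power2_eq_square power3_eq_cube)
qed auto

text \<open>
  The condition \<open>b = 0\<close> on the upper right entry of the first matrix is included because the
  counting lemmas above solve for a variable with coefficient \<open>b\<close>.
\<close>

definition degenerate :: "((int \<times> int \<times> int) \<times> (int \<times> int \<times> int)) set" where
  "degenerate = {(P, Q) \<in> vec3 p \<times> vec3 p. fst (snd P) = 0 \<or> form p P Q = 0 \<or> form p P P = 0
     \<or> form p Q Q = 0 \<or> bracket p (mat_of p P) (mat_of p Q) = 0}"

text \<open>
  The upper right entry of the bracket vanishes only if \<open>a y = b x\<close>, which determines \<open>x\<close>.
\<close>

lemma card_commuting:
  assumes "b \<in> Zn p" "b \<noteq> 0"
  shows "card {Q \<in> vec3 p. bracket p (mat_of p (a, b, c)) (mat_of p Q) = 0} \<le> p\<^sup>2"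
proof -
  let ?S = "{Q \<in> vec3 p. bracket p (mat_of p (a, b, c)) (mat_of p Q) = 0}"
  have *: "int p dvd 2 * (a * y - b * x)" if "bracket p (mat_of p (a, b, c)) (mat_of p (x, y, z)) = 0" for x y z
  proof -
    have "bracket p (mat_of p (a, b, c)) (mat_of p (x, y, z)) $ 1 $ 2 = 0" using that by simp
    then show ?thesis by (simp add: mat_of_def bracket_traceless) (simp add: mat_mod_def dvd_eq_mod_eq_0)
  qed
  have "inj_on snd ?S"
  proof (clarsimp simp: inj_on_def)
    fix x y z x' assume x: "0 \<le> x" "x < int p" "0 \<le> x'" "x' < int p"
      and "bracket p (mat_of p (a, b, c)) (mat_of p (x, y, z)) = 0"
      and "bracket p (mat_of p (a, b, c)) (mat_of p (x', y, z)) = 0"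
    then have "int p dvd 2 * (a * y - b * x') - 2 * (a * y - b * x)"
      using * by (intro dvd_diff)
    then have "int p dvd 2 * (b * (x - x'))" by (simp add: algebra_simps)
    then show "x = x'"
      using not_dvd_2 not_dvd_Zn[OF assms] Zn_eq_if_dvd[of x p x'] x
      by (simp add: prime_dvd_mult_iff[OF prime_int])
  qed
  moreover have "snd ` ?S \<subseteq> Zn p \<times> Zn p" by auto
  ultimately have "card ?S \<le> card (Zn p \<times> Zn p)"
    by (rule card_inj_on_le) simp
  then show ?thesis by (simp add: card_cartesian_product power2_eq_square)
qed

lemma card_degenerate: "card degenerate \<le> 7 * p ^ 5"
proof -
  have fin: "finite {Q \<in> vec3 p. R Q}" for R by (rule finite_subset[of _ "vec3 p"]) auto
  have card3: "card (vec3 p) = p ^ 3" by (simp add: card_cartesian_product power3_eq_cube)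
  define B1 where "B1 = {P \<in> vec3 p. fst (snd P) = 0} \<times> vec3 p"
  define B2 where "B2 = {P \<in> vec3 p. form p P P = 0} \<times> vec3 p"
  define B3 where "B3 = vec3 p \<times> {Q \<in> vec3 p. form p Q Q = 0}"
  define X where "X = {P \<in> vec3 p. fst (snd P) \<noteq> 0}"
  define B4 where "B4 = Sigma X (\<lambda>P. {Q \<in> vec3 p. form p P Q = 0})"
  define B5 where "B5 = Sigma X (\<lambda>P. {Q \<in> vec3 p. bracket p (mat_of p P) (mat_of p Q) = 0})"
  have X: "finite X" "card X \<le> p ^ 3"
    using fin card_mono[of "vec3 p" X] by (auto simp: X_def card3)
  have "{P \<in> vec3 p. fst (snd P) = 0} = Zn p \<times> {0} \<times> Zn p" using p_pos by auto
  then have 1: "card B1 \<le> p ^ 5"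
    by (simp add: B1_def card_cartesian_product card3 power_numeral_reduce)
  have 2: "card B2 \<le> 2 * p ^ 5"
    using mult_right_mono[OF card_sphere[of 0], of "p ^ 3"]
    by (simp only: B2_def card_cartesian_product card3) (simp add: power_numeral_reduce mult_ac)
  have 3: "card B3 \<le> 2 * p ^ 5"
    using mult_right_mono[OF card_sphere[of 0], of "p ^ 3"]
    by (simp only: B3_def card_cartesian_product card3) (simp add: power_numeral_reduce mult_ac)
  have "card B4 \<le> card X * p\<^sup>2"
    unfolding B4_def
  proof (rule card_Sigma_le[OF X(1)])
    fix P assume "P \<in> X"
    then show "finite {Q \<in> vec3 p. form p P Q = 0} \<and> card {Q \<in> vec3 p. form p P Q = 0} \<le> p\<^sup>2"
      using card_plane[of "fst (snd P)" "fst P" "snd (snd P)" 0] fin by (auto simp: X_def)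
  qed
  also have "\<dots> \<le> p ^ 3 * p\<^sup>2" using X(2) by (rule mult_right_mono) simp
  finally have 4: "card B4 \<le> p ^ 5" by (simp add: power_add[symmetric])
  have "card B5 \<le> card X * p\<^sup>2"
    unfolding B5_def
  proof (rule card_Sigma_le[OF X(1)])
    fix P assume "P \<in> X"
    then show "finite {Q \<in> vec3 p. bracket p (mat_of p P) (mat_of p Q) = 0} \<and>
        card {Q \<in> vec3 p. bracket p (mat_of p P) (mat_of p Q) = 0} \<le> p\<^sup>2"
      using card_commuting[of "fst (snd P)" "fst P" "snd (snd P)"] fin by (auto simp: X_def)
  qed
  also have "\<dots> \<le> p ^ 3 * p\<^sup>2" using X(2) by (rule mult_right_mono) simp
  finally have 5: "card B5 \<le> p ^ 5" by (simp add: power_add[symmetric])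
  have finB: "finite (B1 \<union> B2 \<union> B3 \<union> B4 \<union> B5)"
    by (rule finite_subset[of _ "vec3 p \<times> vec3 p"]) (auto simp: B1_def B2_def B3_def B4_def B5_def X_def)
  have "degenerate \<subseteq> B1 \<union> B2 \<union> B3 \<union> B4 \<union> B5"
    by (auto simp: degenerate_def B1_def B2_def B3_def B4_def B5_def X_def)
  then have "card degenerate \<le> card (B1 \<union> B2 \<union> B3 \<union> B4 \<union> B5)" by (rule card_mono[OF finB])
  also have "\<dots> \<le> card B1 + card B2 + card B3 + card B4 + card B5"
    using card_Un_le[of "B1 \<union> B2 \<union> B3 \<union> B4" B5] card_Un_le[of "B1 \<union> B2 \<union> B3" B4]
      card_Un_le[of "B1 \<union> B2" B3] card_Un_le[of B1 B2] by linarith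
  also have "\<dots> \<le> 7 * p ^ 5" using 1 2 3 4 5 by linarith
  finally show ?thesis .
qed

end

section \<open>Total variation distance and concentration\<close>

lemma pmf_map_inj_on:
  assumes "inj_on f S" "set_pmf M \<subseteq> S" "x \<in> S"
  shows "pmf (map_pmf f M) (f x) = pmf M x"
proof -
  have "measure (measure_pmf M) (f -` {f x}) = measure (measure_pmf M) {x}"
    by (rule measure_prob_cong_0) (use assms in \<open>auto simp: pmf_eq_0_set_pmf inj_on_def\<close>)
  then show ?thesis by (simp add: pmf_map measure_pmf_single)
qed

lemma tv_dist_map_inj:
  fixes f :: "'a \<Rightarrow> 'b"
  assumes "inj_on f S" "finite S" "set_pmf M \<subseteq> S" "set_pmf N \<subseteq> S"
  shows "tv_dist (map_pmf f M) (map_pmf f N) = (\<Sum>x\<in>S. \<bar>pmf M x - pmf N x\<bar>) / 2"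
proof -
  have "(\<Sum>\<^sub>\<infinity>y. \<bar>pmf (map_pmf f M) y - pmf (map_pmf f N) y\<bar>)
      = (\<Sum>\<^sub>\<infinity>y\<in>f ` S. \<bar>pmf (map_pmf f M) y - pmf (map_pmf f N) y\<bar>)"
  proof (rule infsum_cong_neutral)
    fix y assume "y \<in> UNIV - f ` S"
    then have "y \<notin> f ` set_pmf M" "y \<notin> f ` set_pmf N" using assms(3,4) by auto
    then show "\<bar>pmf (map_pmf f M) y - pmf (map_pmf f N) y\<bar> = 0"
      by (simp add: pmf_map_outside)
  qed auto
  also have "\<dots> = (\<Sum>x\<in>S. \<bar>pmf (map_pmf f M) (f x) - pmf (map_pmf f N) (f x)\<bar>)"
    using assms(1,2) by (simp add: sum.reindex)
  also have "\<dots> = (\<Sum>x\<in>S. \<bar>pmf M x - pmf N x\<bar>)"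
    by (intro sum.cong refl) (simp add: pmf_map_inj_on[OF assms(1)] assms(3,4))
  finally show ?thesis by (simp add: tv_dist_def)
qed

text \<open>
  For two probability vectors the positive and the negative part of the difference have equal mass,
  hence the factor \<open>2\<close>.
\<close>

lemma sum_abs_diff_ge:
  fixes f g :: "'a \<Rightarrow> real"
  assumes "finite C" "S \<subseteq> C" "sum f C = sum g C"
  shows "2 * (sum f S - sum g S) \<le> (\<Sum>x\<in>C. \<bar>f x - g x\<bar>)"
proof -
  have "2 * (sum f S - sum g S) = (\<Sum>x\<in>S. f x - g x) + (\<Sum>x\<in>C - S. g x - f x)"
    using assms by (simp add: sum_subtractf sum_diff)
  also have "\<dots> \<le> (\<Sum>x\<in>S. \<bar>f x - g x\<bar>) + (\<Sum>x\<in>C - S. \<bar>f x - g x\<bar>)"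
    by (intro add_mono sum_mono) auto
  also have "\<dots> = (\<Sum>x\<in>C. \<bar>f x - g x\<bar>)"
    using assms by (simp add: sum.subset_diff[of S C] add.commute)
  finally show ?thesis .
qed

lemma count_walk_concentration:
  assumes "r > 0"
  shows "measure_pmf.prob (count_walk k) {(h, i, j). (real i - real k / 4)\<^sup>2 + (real j - real k / 4)\<^sup>2 \<ge> r}
    \<le> 3 * real k / (8 * r)"
proof -
  let ?f = "\<lambda>(h, i, j). (real i - real k / 4)\<^sup>2 + (real j - real k / 4)\<^sup>2"
  have int: "integrable (measure_pmf (count_walk k)) f" for f :: "nat \<times> nat \<times> nat \<Rightarrow> real"
    by (rule integrable_measure_pmf_finite[OF finite_count_walk])
  have "measure_pmf.prob (count_walk k) {(h :: nat, i, j). (real i - real k / 4)\<^sup>2 + (real j - real k / 4)\<^sup>2 \<ge> r}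
      = measure_pmf.expectation (count_walk k)
          (indicator {(h, i, j). (real i - real k / 4)\<^sup>2 + (real j - real k / 4)\<^sup>2 \<ge> r})"
    by simp
  also have "\<dots> \<le> measure_pmf.expectation (count_walk k) (\<lambda>s. ?f s / r)"
    by (intro integral_mono int) (use assms in \<open>auto simp: indicator_def field_simps split: prod.splits\<close>)
  also have "\<dots> = 3 * real k / 8 / r"
    by (simp only: integral_divide_zero count_walk_variance)
  finally show ?thesis by simp
qed

lemma card_nat_near:
  fixes x r :: real
  assumes "r \<ge> 0"
  shows "finite {i :: nat. \<bar>real i - x\<bar> \<le> r}" "card {i :: nat. \<bar>real i - x\<bar> \<le> r} \<le> 2 * r + 1"
proof -
  have inj: "inj_on int {i :: nat. \<bar>real i - x\<bar> \<le> r}" by (simp add: inj_on_def)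
  have sub: "int ` {i :: nat. \<bar>real i - x\<bar> \<le> r} \<subseteq> {\<lceil>x - r\<rceil>..\<lfloor>x + r\<rfloor>}"
    by (auto simp: ceiling_le_iff le_floor_iff)
  show "finite {i :: nat. \<bar>real i - x\<bar> \<le> r}"
    using finite_imageD[OF finite_subset[OF sub] inj] by simp
  have "card {i :: nat. \<bar>real i - x\<bar> \<le> r} \<le> card {\<lceil>x - r\<rceil>..\<lfloor>x + r\<rfloor>}"
    by (rule card_inj_on_le[OF inj sub]) simp
  then have "real (card {i :: nat. \<bar>real i - x\<bar> \<le> r}) \<le> real (nat (\<lfloor>x + r\<rfloor> - \<lceil>x - r\<rceil> + 1))"
    by simp
  also have "\<dots> \<le> 2 * r + 1"
  proof -
    have "real_of_int (\<lfloor>x + r\<rfloor> - \<lceil>x - r\<rceil> + 1) \<le> 2 * r + 1"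
      using of_int_floor_le[of "x + r"] le_of_int_ceiling[of "x - r"] by (simp del: of_int_floor_le le_of_int_ceiling)
    then show ?thesis using assms by (cases "\<lfloor>x + r\<rfloor> - \<lceil>x - r\<rceil> + 1 \<ge> 0") auto
  qed
  finally show "card {i :: nat. \<bar>real i - x\<bar> \<le> r} \<le> 2 * r + 1" .
qed

text \<open>
  The total of the three counts is \<open>k\<close>, so two of them determine the third. The walk therefore explores
  a two-dimensional region, whose area is of the order of the variance.
\<close>

lemma count_walk_small_support:
  fixes r :: real
  assumes "r \<ge> 1"
  obtains S where "finite S" "real (card S) \<le> 9 * r\<^sup>2"
    "measure_pmf.prob (count_walk k) S \<ge> 1 - 3 * real k / (8 * r\<^sup>2)"
proof -
  let ?I = "{i :: nat. \<bar>real i - real k / 4\<bar> \<le> r}"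
  let ?S = "(\<lambda>(i, j). (k - i - j, i, j)) ` (?I \<times> ?I)"
  let ?B = "{(h, i, j). (real i - real k / 4)\<^sup>2 + (real j - real k / 4)\<^sup>2 \<ge> r\<^sup>2}"
  have fin: "finite (?I \<times> ?I)" using card_nat_near(1)[of r] assms by simp
  have "real (card ?S) \<le> real (card ?I) * real (card ?I)"
    using card_image_le[OF fin, of "\<lambda>(i, j). (k - i - j, i, j)"]
    by (simp add: card_cartesian_product flip: of_nat_mult)
  also have "\<dots> \<le> (3 * r) * (3 * r)"
    using card_nat_near(2)[of r "real k / 4"] assms by (intro mult_mono) auto
  finally have card: "real (card ?S) \<le> 9 * r\<^sup>2" by (simp add: power2_eq_square)
  have out: "s \<in> ?B" if s: "s \<in> set_pmf (count_walk k)" "s \<notin> ?S" for s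
  proof -
    obtain h i j where hij: "s = (h, i, j)" by (cases s)
    then have h: "h = k - i - j" using count_walk_total[of h i j k] s(1) by auto
    have "\<not> (i \<in> ?I \<and> j \<in> ?I)" using s(2) by (force simp: hij h image_iff)
    then have "r\<^sup>2 \<le> (real i - real k / 4)\<^sup>2 \<or> r\<^sup>2 \<le> (real j - real k / 4)\<^sup>2"
      using assms by (auto simp: abs_le_square_iff[symmetric] not_le)
    then show ?thesis
      using zero_le_power2[of "real i - real k / 4"] zero_le_power2[of "real j - real k / 4"]
      by (auto simp: hij intro: order.trans simp del: zero_le_power2)
  qed
  have "measure_pmf.prob (count_walk k) (- ?S) = measure_pmf.prob (count_walk k) (- ?S \<inter> set_pmf (count_walk k))"
    by (simp add: measure_Int_set_pmf)
  also have "\<dots> \<le> measure_pmf.prob (count_walk k) ?B"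
    by (rule measure_pmf.finite_measure_mono) (use out in auto)
  also have "\<dots> \<le> 3 * real k / (8 * r\<^sup>2)"
    by (rule count_walk_concentration) (use assms in auto)
  finally have "measure_pmf.prob (count_walk k) ?S \<ge> 1 - 3 * real k / (8 * r\<^sup>2)"
    using measure_pmf.prob_compl[of ?S "count_walk k"] by (simp add: Compl_eq_Diff_UNIV)
  then show ?thesis using that[of ?S] fin card by blast
qed

section \<open>Discrete logarithms and cosets\<close>

lemma annihilator_add: "z \<in> annihilator n J \<Longrightarrow> w \<in> annihilator n J \<Longrightarrow> z + w \<in> annihilator n J"
  by (simp add: annihilator_def distrib_left)

lemma annihilator_uminus: "z \<in> annihilator n J \<Longrightarrow> - z \<in> annihilator n J"
  by (simp add: annihilator_def)

lemma annihilator_cong: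
  assumes "[z = w] (mod int n)"
  shows "z \<in> annihilator n J \<longleftrightarrow> w \<in> annihilator n J"
proof -
  have "int n dvd j * z \<longleftrightarrow> int n dvd j * w" for j
    by (rule cong_dvd_iff) (rule cong_mult[OF cong_refl assms])
  then show ?thesis by (simp add: annihilator_def)
qed

locale discrete_log = odd_prime +
  fixes lg :: "int \<Rightarrow> int"
  assumes lg: "lg \<in> iso (Fp_mult p) (integer_mod_group (p - 1))"
begin

abbreviation "n \<equiv> p - 1"
abbreviation "U \<equiv> {1..int p - 1}"

lemma p_ge_3: "p \<ge> 3"
  using prime_ge_2_nat[OF pr] odd by (cases "p = 2") auto

lemma carrier_Fp_mult: "carrier (Fp_mult p) = U"
proof -
  interpret residues_prime p "Fp p"
    by unfold_locales (use pr p_ge_3 in auto)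
  show ?thesis using p_ge_3 by (simp add: units_of_carrier res_prime_units_eq of_nat_diff)
qed

lemma group_Fp_mult: "group (Fp_mult p)"
proof -
  interpret residues_prime p "Fp p"
    by unfold_locales (use pr p_ge_3 in auto)
  show ?thesis by (rule units_group)
qed

lemma mult_Fp_mult: "x \<otimes>\<^bsub>Fp_mult p\<^esub> y = x * y mod int p"
  by (simp add: units_of_mult residue_ring_def)

lemma U_mult: "x \<in> U \<Longrightarrow> y \<in> U \<Longrightarrow> x * y mod int p \<in> U"
  using group.is_monoid[OF group_Fp_mult, THEN monoid.m_closed, of x y]
  by (simp add: carrier_Fp_mult mult_Fp_mult)

lemma lg_bij: "bij_betw lg U (Zn n)"
  using lg p_ge_3 by (simp add: iso_def carrier_Fp_mult carrier_integer_mod_group)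

lemma lg_mult: "x \<in> U \<Longrightarrow> y \<in> U \<Longrightarrow> [lg (x * y mod int p) = lg x + lg y] (mod int n)"
  using lg by (simp add: iso_def hom_def carrier_Fp_mult mult_Fp_mult cong_def)

lemma lg_one: "[lg 1 = 0] (mod int n)"
proof -
  have "[lg 1 = lg 1 + lg 1] (mod int n)"
    using lg_mult[of 1 1] p_ge_3 by simp
  then have "[lg 1 + 0 = lg 1 + lg 1] (mod int n)" by simp
  then show ?thesis unfolding cong_add_lcancel by (rule cong_sym)
qed

lemma lg_power: "x \<in> U \<Longrightarrow> x ^ k mod int p \<in> U \<and> [lg (x ^ k mod int p) = int k * lg x] (mod int n)"
proof (induction k)
  case 0
  then show ?case using p_ge_3 lg_one by (simp add: mod_pos_pos_trivial)
next
  case (Suc k)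
  let ?y = "x ^ k mod int p"
  have eq: "x ^ Suc k mod int p = x * ?y mod int p" by (simp add: mod_mult_right_eq)
  have "[lg (x * ?y mod int p) = lg x + lg ?y] (mod int n)"
    using Suc by (intro lg_mult) auto
  also have "[lg x + lg ?y = lg x + int k * lg x] (mod int n)"
    using Suc by (intro cong_add cong_refl) auto
  finally show ?case
    using U_mult[of x ?y] Suc unfolding eq by (simp add: algebra_simps)
qed

text \<open>
  With \<open>J\<close> the set of peaks and \<open>u = k \<alpha>'\<close>, this is the coset on which the \<open>k\<close>-th limiting distribution is
  uniform; it is a subgroup for \<open>u = 0\<close>.
\<close>

definition log_coset :: "int set \<Rightarrow> int \<Rightarrow> int set" where
  "log_coset J u = {c \<in> U. lg c - u \<in> annihilator n J}"

lemma lg_inv: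
  assumes "x \<in> U"
  shows "inv\<^bsub>Fp_mult p\<^esub> x \<in> U" "[lg (inv\<^bsub>Fp_mult p\<^esub> x) = - lg x] (mod int n)"
proof -
  interpret group "Fp_mult p" by (rule group_Fp_mult)
  show U: "inv\<^bsub>Fp_mult p\<^esub> x \<in> U" using inv_closed[of x] assms by (simp add: carrier_Fp_mult)
  have "x * inv\<^bsub>Fp_mult p\<^esub> x mod int p = 1"
    using r_inv[of x] assms carrier_Fp_mult mult_Fp_mult[of x "inv\<^bsub>Fp_mult p\<^esub> x"]
    by (simp add: units_of_one residue_ring_def)
  then have "[lg 1 = lg x + lg (inv\<^bsub>Fp_mult p\<^esub> x)] (mod int n)"
    using lg_mult[OF assms U] by simp
  then have "[0 = lg x + lg (inv\<^bsub>Fp_mult p\<^esub> x)] (mod int n)"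
    using lg_one cong_trans cong_sym by blast
  then have "[0 + - lg x = lg x + lg (inv\<^bsub>Fp_mult p\<^esub> x) + - lg x] (mod int n)"
    by (rule cong_add) simp
  then show "[lg (inv\<^bsub>Fp_mult p\<^esub> x) = - lg x] (mod int n)"
    by (simp add: cong_sym)
qed

lemma log_coset_subgroup: "subgroup (log_coset J 0) (Fp_mult p)"
proof (rule group.subgroupI[OF group_Fp_mult])
  show "log_coset J 0 \<subseteq> carrier (Fp_mult p)" by (auto simp: log_coset_def carrier_Fp_mult)
  have "1 \<in> log_coset J 0"
    using annihilator_cong[OF lg_one, of J] p_ge_3 by (simp add: log_coset_def annihilator_def)
  then show "log_coset J 0 \<noteq> {}" by blast
next
  fix x assume x: "x \<in> log_coset J 0"
  then have "- lg x \<in> annihilator n J"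
    by (intro annihilator_uminus) (simp add: log_coset_def)
  then show "inv\<^bsub>Fp_mult p\<^esub> x \<in> log_coset J 0"
    using x lg_inv[of x] annihilator_cong[OF lg_inv(2)[of x], of J] by (simp add: log_coset_def)
next
  fix x y assume xy: "x \<in> log_coset J 0" "y \<in> log_coset J 0"
  then have "lg x + lg y \<in> annihilator n J"
    by (intro annihilator_add) (simp_all add: log_coset_def)
  then show "x \<otimes>\<^bsub>Fp_mult p\<^esub> y \<in> log_coset J 0"
    using xy U_mult[of x y] annihilator_cong[OF lg_mult[of x y], of J]
    by (simp add: log_coset_def mult_Fp_mult)
qed

text \<open>
  Any element whose logarithm is \<open>u\<close> modulo \<open>n\<close> represents the coset.
\<close>

lemma log_coset_rcoset: "log_coset J u \<in> rcosets\<^bsub>Fp_mult p\<^esub> (log_coset J 0)"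
proof -
  interpret group "Fp_mult p" by (rule group_Fp_mult)
  have "u mod int n \<in> lg ` U"
    using lg_bij p_ge_3 by (simp add: bij_betw_def)
  then obtain g where g: "g \<in> U" and "lg g = u mod int n" by (metis imageE)
  then have lg_g: "[lg g = u] (mod int n)" by (simp add: cong_def del: of_nat_diff)
  have "log_coset J u = log_coset J 0 #>\<^bsub>Fp_mult p\<^esub> g"
  proof (intro equalityI subsetI)
    fix c assume c: "c \<in> log_coset J u"
    let ?h = "c \<otimes>\<^bsub>Fp_mult p\<^esub> inv\<^bsub>Fp_mult p\<^esub> g"
    have cU: "c \<in> U" using c by (simp add: log_coset_def)
    have h: "?h = c * inv\<^bsub>Fp_mult p\<^esub> g mod int p" by (rule mult_Fp_mult)
    have "[lg ?h = lg c + lg (inv\<^bsub>Fp_mult p\<^esub> g)] (mod int n)"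
      unfolding h by (rule lg_mult[OF cU lg_inv(1)[OF g]])
    also have "[lg c + lg (inv\<^bsub>Fp_mult p\<^esub> g) = lg c + - lg g] (mod int n)"
      by (intro cong_add cong_refl lg_inv(2)[OF g])
    also have "[lg c + - lg g = lg c + - u] (mod int n)"
      using lg_g by (intro cong_add cong_refl) (simp add: cong_minus_minus_iff)
    finally have "?h \<in> log_coset J 0"
      using c U_mult[OF cU lg_inv(1)[OF g]] annihilator_cong[of "lg ?h" "lg c - u" n J]
      by (simp add: log_coset_def h)
    moreover have "c = ?h \<otimes>\<^bsub>Fp_mult p\<^esub> g"
    proof -
      have "c \<in> carrier (Fp_mult p)" "g \<in> carrier (Fp_mult p)" using cU g carrier_Fp_mult by auto
      then show ?thesis by (simp add: m_assoc)
    qed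
    ultimately show "c \<in> log_coset J 0 #>\<^bsub>Fp_mult p\<^esub> g"
      unfolding r_coset_def by blast
  next
    fix c assume "c \<in> log_coset J 0 #>\<^bsub>Fp_mult p\<^esub> g"
    then obtain h where h: "h \<in> log_coset J 0" "c = h * g mod int p"
      by (auto simp: r_coset_def mult_Fp_mult)
    then have hU: "h \<in> U" by (simp add: log_coset_def)
    have "[lg c - u = lg h + lg g - lg g] (mod int n)"
      unfolding h(2) using lg_g by (intro cong_diff lg_mult hU g) (rule cong_sym)
    then show "c \<in> log_coset J u"
      using h U_mult[OF hU g] annihilator_cong[of "lg c - u" "lg h" n J]
      by (simp add: log_coset_def)
  qed
  then show ?thesis using g by (auto simp: RCOSETS_def carrier_Fp_mult)
qed

lemma lg_image_log_coset: "lg ` log_coset J u = {z \<in> Zn n. z - u \<in> annihilator n J}"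
proof -
  have "lg ` U = Zn n" using lg_bij by (simp add: bij_betw_def)
  moreover have "lg ` {c \<in> U. R (lg c)} = {z \<in> lg ` U. R z}" for R by blast
  from this[of "\<lambda>z. z - u \<in> annihilator n J"]
  have "lg ` log_coset J u = {z \<in> lg ` U. z - u \<in> annihilator n J}" by (simp only: log_coset_def)
  ultimately show ?thesis by (simp only:)
qed

lemma card_log_coset: "card (log_coset (peaks n x y) u) * card (peaks n x y) = n"
proof -
  have "inj_on lg (log_coset (peaks n x y) u)"
    by (rule inj_on_subset[OF bij_betw_imp_inj_on[OF lg_bij]]) (auto simp: log_coset_def)
  then have "card (log_coset (peaks n x y) u) = card {z \<in> Zn n. z - u \<in> annihilator n (peaks n x y)}"
    using card_image[of lg "log_coset (peaks n x y) u"] by (simp only: lg_image_log_coset)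
  then show ?thesis using card_annihilator_coset[of n u x y] p_ge_3 by (simp only: \<open>card (log_coset _ _) = _\<close>)
qed

lemma finite_log_coset: "finite (log_coset J u)"
  by (rule finite_subset[of _ U]) (auto simp: log_coset_def)

lemma log_coset_nonempty: "log_coset (peaks n x y) u \<noteq> {}"
  using card_log_coset[of x y u] p_ge_3 by auto

definition monomial :: "int \<Rightarrow> int \<Rightarrow> int \<Rightarrow> nat \<times> nat \<times> nat \<Rightarrow> int" where
  "monomial \<alpha> \<beta> \<gamma> = (\<lambda>(h, i, j). \<alpha> ^ h * \<beta> ^ i * \<gamma> ^ j mod int p)"

lemma lg_monomial:
  assumes "\<alpha> \<in> U" "\<beta> \<in> U" "\<gamma> \<in> U"
  shows "monomial \<alpha> \<beta> \<gamma> s \<in> U" "lg (monomial \<alpha> \<beta> \<gamma> s) = walk_residue n (lg \<alpha>) (lg \<beta>) (lg \<gamma>) s"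
proof -
  obtain h i j where s: "s = (h, i, j)" by (cases s)
  let ?a = "\<alpha> ^ h mod int p" and ?b = "\<beta> ^ i mod int p" and ?c = "\<gamma> ^ j mod int p"
  have a: "?a \<in> U" and b: "?b \<in> U" and c: "?c \<in> U"
    using lg_power assms by blast+
  have ab: "?a * ?b mod int p \<in> U" by (rule U_mult[OF a b])
  have m: "monomial \<alpha> \<beta> \<gamma> s = (?a * ?b mod int p) * ?c mod int p"
    by (simp add: monomial_def s mod_simps)
  show U: "monomial \<alpha> \<beta> \<gamma> s \<in> U" unfolding m by (rule U_mult[OF ab c])
  have "[lg (monomial \<alpha> \<beta> \<gamma> s) = lg (?a * ?b mod int p) + lg ?c] (mod int n)"
    unfolding m by (rule lg_mult[OF ab c])
  also have "[lg (?a * ?b mod int p) + lg ?c = (lg ?a + lg ?b) + lg ?c] (mod int n)"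
    by (intro cong_add lg_mult a b cong_refl)
  also have "[(lg ?a + lg ?b) + lg ?c = (int h * lg \<alpha> + int i * lg \<beta>) + int j * lg \<gamma>] (mod int n)"
    using lg_power assms by (intro cong_add) blast+
  finally have "lg (monomial \<alpha> \<beta> \<gamma> s) mod int n = walk_residue n (lg \<alpha>) (lg \<beta>) (lg \<gamma>) s"
    by (simp add: walk_residue_def s cong_def)
  moreover have "lg (monomial \<alpha> \<beta> \<gamma> s) \<in> Zn n"
    using lg_bij U by (auto simp: bij_betw_def)
  ultimately show "lg (monomial \<alpha> \<beta> \<gamma> s) = walk_residue n (lg \<alpha>) (lg \<beta>) (lg \<gamma>) s" by simp
qed

end

section \<open>Distance from the limiting distribution\<close>

lemma scale_bracket_inj:
  assumes "bracket p A B \<noteq> 0" "prime p"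
  shows "inj_on (\<lambda>c. scale p c (bracket p A B)) (Zn p)"
proof
  obtain i j where e: "bracket p A B $ i $ j \<noteq> 0" using assms(1) by (auto simp: vec_eq_iff)
  have p: "p > 0" using assms(2) by (rule prime_gt_0_nat)
  have "bracket p A B $ i $ j \<in> Zn p" using p by (simp add: bracket_def mat_mod_def)
  then have nd: "\<not> int p dvd bracket p A B $ i $ j" by (rule not_dvd_Zn) (rule e)
  fix c c' assume c: "c \<in> Zn p" "c' \<in> Zn p" and eq: "scale p c (bracket p A B) = scale p c' (bracket p A B)"
  have "c * bracket p A B $ i $ j mod int p = c' * bracket p A B $ i $ j mod int p"
    using arg_cong[OF eq, of "\<lambda>M. M $ i $ j"] by (simp add: scale_def)
  then have "int p dvd (c - c') * bracket p A B $ i $ j"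
    by (simp add: mod_eq_dvd_iff left_diff_distrib)
  then have "int p dvd c - c'" using nd assms(2) by (simp add: prime_dvd_mult_iff)
  then show "c = c'" by (rule Zn_eq_if_dvd[OF c])
qed

context discrete_log
begin

definition line_coset_pmf :: "mat2 \<Rightarrow> int set \<Rightarrow> int \<Rightarrow> mat2 pmf" where
  "line_coset_pmf V J u = map_pmf (\<lambda>c. scale p c V) (pmf_of_set (log_coset J u))"

lemma log_coset_subset: "log_coset J u \<subseteq> U"
  by (auto simp: log_coset_def)

lemma set_pmf_log_coset: "set_pmf (pmf_of_set (log_coset (peaks n x y) u)) \<subseteq> U"
  unfolding set_pmf_of_set[OF log_coset_nonempty finite_log_coset] by (rule log_coset_subset)

lemma pmf_log_coset:
  "pmf (pmf_of_set (log_coset (peaks n x y) u)) c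
    = indicator (log_coset (peaks n x y) u) c * (real (card (peaks n x y)) / n)"
proof -
  have recip: "1 / s = t / m" if "s * t = m" "m > 0" for s t m :: real
    using that by (auto simp: field_simps)
  have "1 / real (card (log_coset (peaks n x y) u)) = real (card (peaks n x y)) / real n"
  proof (rule recip)
    show "real (card (log_coset (peaks n x y) u)) * real (card (peaks n x y)) = real n"
      by (simp only: card_log_coset flip: of_nat_mult)
    show "real n > 0" using p_ge_3 by simp
  qed
  moreover have "pmf (pmf_of_set (log_coset (peaks n x y) u)) c
    = indicator (log_coset (peaks n x y) u) c * (1 / real (card (log_coset (peaks n x y) u)))"
    unfolding pmf_of_set[OF log_coset_nonempty finite_log_coset] by simp
  ultimately show ?thesis by (simp only:)
qed

lemma pmf_log_coset_eq_phi:
  assumes "c \<in> U"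
  shows "complex_of_real (pmf (pmf_of_set (log_coset (peaks n (b - a) (g - a)) (int k * a))) c)
    = phi n a b g k (lg c)"
proof -
  have n: "n > 0" using p_ge_3 by simp
  show ?thesis
    using assms unfolding pmf_log_coset phi_closed_form[OF n]
    by (simp only: log_coset_def indicator_def mem_Collect_eq) simp
qed

lemma pmf_log_coset_le:
  "pmf (pmf_of_set (log_coset (peaks n x y) u)) c \<le> real (card (peaks n x y)) / n"
  unfolding pmf_log_coset by (rule mult_left_le_one_le) (auto simp: indicator_def)

context
  fixes P Q :: "int \<times> int \<times> int"
  assumes PQ: "P \<in> vec3 p" "Q \<in> vec3 p" and nondeg: "(P, Q) \<notin> degenerate"
begin

abbreviation "A \<equiv> mat_of p P"
abbreviation "B \<equiv> mat_of p Q"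
abbreviation "V \<equiv> bracket p A B"
abbreviation "\<alpha> \<equiv> form p P Q"
abbreviation "\<beta> \<equiv> form p P P"
abbreviation "\<gamma> \<equiv> form p Q Q"
abbreviation "J \<equiv> peaks n (lg \<beta> - lg \<alpha>) (lg \<gamma> - lg \<alpha>)"
abbreviation "limit k \<equiv> line_coset_pmf V J (int k * lg \<alpha>)"

lemma AB: "A \<in> sl2 p" "B \<in> sl2 p"
  using bij_mat_of[OF p_pos] PQ by (auto simp: bij_betw_def)

lemma forms_in_U: "\<alpha> \<in> U" "\<beta> \<in> U" "\<gamma> \<in> U"
proof -
  have "form p X Y \<noteq> 0 \<Longrightarrow> form p X Y \<in> U" for X Y
    using form_in_Zn[OF p_pos, of X Y] by auto
  then show "\<alpha> \<in> U" "\<beta> \<in> U" "\<gamma> \<in> U"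
    using nondeg PQ by (auto simp: degenerate_def)
qed

lemma V_nonzero: "V \<noteq> 0"
  using nondeg PQ by (auto simp: degenerate_def)

lemma scale_inj_U: "inj_on (\<lambda>c. scale p c V) U"
  by (rule inj_on_subset[OF scale_bracket_inj[OF V_nonzero pr]]) auto

lemma limiting_dist_limit: "limiting_dist p lg A B k (limit k)"
proof -
  have sub: "set_pmf (pmf_of_set (log_coset J (int k * lg \<alpha>))) \<subseteq> U"
    by (rule set_pmf_log_coset)
  have "\<not> int p dvd \<alpha> * \<beta> * \<gamma>"
    using forms_in_U by (auto simp: prime_dvd_mult_iff[OF prime_int] dest: zdvd_imp_le)
  then show ?thesis
    unfolding limiting_dist_def Let_def form_eq_tr carrier_Fp_mult
  proof (intro conjI ballI allI impI V_nonzero)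
    fix c assume "c \<in> U"
    then show "complex_of_real (pmf (limit k) (scale p c V)) = phi n (lg \<alpha>) (lg \<beta>) (lg \<gamma>) k (lg c)"
      unfolding line_coset_pmf_def pmf_map_inj_on[OF scale_inj_U sub \<open>c \<in> U\<close>]
      by (rule pmf_log_coset_eq_phi)
  next
    fix X assume "X \<notin> (\<lambda>c. scale p c V) ` U"
    then show "pmf (limit k) X = 0"
      unfolding line_coset_pmf_def using sub by (intro pmf_map_outside) auto
  qed (simp add: dvd_eq_mod_eq_0)
qed

lemma uniform_on_coset_limit: "uniform_on_coset p V (limit k)"
  unfolding uniform_on_coset_def line_coset_pmf_def
  using log_coset_subgroup log_coset_rcoset by blast

abbreviation "walk k \<equiv> map_pmf (monomial \<alpha> \<beta> \<gamma>) (count_walk k)"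

lemma set_walk: "set_pmf (walk k) \<subseteq> U"
  using lg_monomial(1)[OF forms_in_U] by auto

lemma tv_dist_limit:
  "tv_dist (lie_bracket_pmf p A B (2 * k)) (limit k)
    = (\<Sum>c\<in>U. \<bar>pmf (walk k) c - pmf (pmf_of_set (log_coset J (int k * lg \<alpha>))) c\<bar>) / 2"
proof -
  have cong: "[form p X Y = 2 * tr p (mat_of p X ** mat_of p Y)] (mod int p)" for X Y
    by (simp add: cong_def form_eq_tr[symmetric])
  have "lie_bracket_pmf p A B (2 * k) =
      map_pmf (\<lambda>(h, i, j). scale p (\<alpha> ^ h * \<beta> ^ i * \<gamma> ^ j) V) (count_walk k)"
    by (rule lie_bracket_pmf_even[OF AB p_pos cong cong cong])
  also have "\<dots> = map_pmf (\<lambda>c. scale p c V) (walk k)"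
    unfolding pmf.map_comp
    by (rule map_pmf_cong) (auto simp: monomial_def intro!: scale_cong)
  finally have lie: "lie_bracket_pmf p A B (2 * k) = map_pmf (\<lambda>c. scale p c V) (walk k)" .
  show ?thesis
    unfolding lie line_coset_pmf_def
    by (rule tv_dist_map_inj[OF scale_inj_U finite_atLeastAtMost_int set_walk set_pmf_log_coset])
qed

text \<open>
  Passing to logarithms turns the distance into the one between the walk on \<open>\<int>/n\<close> and \<open>\<phi>\<^sub>k\<close>. The
  parameter \<open>t\<close> replaces \<open>k\<close> so that a single bound serves all later times.
\<close>

lemma tv_dist_limit_upper:
  assumes "real k \<ge> t"
  shows "(2 * tv_dist (lie_bracket_pmf p A B (2 * k)) (limit k))\<^sup>2
    \<le> fourier_tail n t (lg \<beta> - lg \<alpha>) (lg \<gamma> - lg \<alpha>)"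
proof -
  have n: "n > 0" using p_ge_3 by simp
  have walk: "map_pmf lg (walk k) = map_pmf (walk_residue n (lg \<alpha>) (lg \<beta>) (lg \<gamma>)) (count_walk k)"
    unfolding pmf.map_comp by (simp add: o_def lg_monomial(2)[OF forms_in_U])
  define D where "D z = cmod (complex_of_real (pmf (map_pmf lg (walk k)) z)
    - phi n (lg \<alpha>) (lg \<beta>) (lg \<gamma>) k z)" for z
  have "2 * tv_dist (lie_bracket_pmf p A B (2 * k)) (limit k) = (\<Sum>c\<in>U. D (lg c))"
  proof -
    have "\<bar>pmf (walk k) c - pmf (pmf_of_set (log_coset J (int k * lg \<alpha>))) c\<bar> = D (lg c)" if "c \<in> U" for c
      unfolding D_def pmf_log_coset_eq_phi[OF that, symmetric]
        pmf_map_inj_on[OF bij_betw_imp_inj_on[OF lg_bij] set_walk that] of_real_diff[symmetric] norm_of_real ..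
    then show ?thesis unfolding tv_dist_limit by simp
  qed
  also have "\<dots> = (\<Sum>z\<in>Zn n. D z)"
    by (rule sum.reindex_bij_betw[OF lg_bij])
  finally have "(2 * tv_dist (lie_bracket_pmf p A B (2 * k)) (limit k))\<^sup>2 = (\<Sum>z\<in>Zn n. D z)\<^sup>2" by simp
  also have "\<dots> \<le> (\<Sum>j\<in>Zn n - J. exp (- (real k * decay n (lg \<beta> - lg \<alpha>) (lg \<gamma> - lg \<alpha>) j)))"
    unfolding D_def walk by (rule walk_l1_bound[OF n])
  also have "\<dots> \<le> fourier_tail n t (lg \<beta> - lg \<alpha>) (lg \<gamma> - lg \<alpha>)"
    unfolding fourier_tail_def
    by (intro sum_mono) (use assms in \<open>auto intro!: mult_right_mono decay_nonneg\<close>)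
  finally show ?thesis .
qed

text \<open>
  The walk is concentrated on at most \<open>9 r\<^sup>2\<close> points, to each of which the limit gives mass at most
  \<open>|J|/n\<close>.
\<close>

lemma tv_dist_limit_lower:
  assumes "r \<ge> 1"
  shows "tv_dist (lie_bracket_pmf p A B (2 * k)) (limit k)
    \<ge> 1 - 3 * real k / (8 * r\<^sup>2) - 9 * r\<^sup>2 * (real (card J) / n)"
proof -
  obtain S where S: "finite S" "real (card S) \<le> 9 * r\<^sup>2"
    "measure_pmf.prob (count_walk k) S \<ge> 1 - 3 * real k / (8 * r\<^sup>2)"
    by (rule count_walk_small_support[OF assms])
  let ?T = "monomial \<alpha> \<beta> \<gamma> ` S"
  let ?\<nu> = "pmf_of_set (log_coset J (int k * lg \<alpha>))"
  have T: "?T \<subseteq> U" using lg_monomial(1)[OF forms_in_U] by blast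
  have finT: "finite ?T" using S(1) by simp
  have "measure_pmf.prob (count_walk k) S \<le> measure_pmf.prob (count_walk k) (monomial \<alpha> \<beta> \<gamma> -` ?T)"
    by (rule measure_pmf.finite_measure_mono) auto
  also have "\<dots> = measure_pmf.prob (walk k) ?T" by simp
  also have "\<dots> = (\<Sum>c\<in>?T. pmf (walk k) c)" by (rule measure_measure_pmf_finite[OF finT])
  finally have 1: "sum (pmf (walk k)) ?T \<ge> 1 - 3 * real k / (8 * r\<^sup>2)" using S(3) by simp
  have "sum (pmf ?\<nu>) ?T \<le> real (card ?T) * (real (card J) / n)"
    by (rule sum_bounded_above) (rule pmf_log_coset_le)
  also have "\<dots> \<le> 9 * r\<^sup>2 * (real (card J) / n)"
    using card_image_le[OF S(1), of "monomial \<alpha> \<beta> \<gamma>"] S(2) by (intro mult_right_mono) auto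
  finally have 2: "sum (pmf ?\<nu>) ?T \<le> 9 * r\<^sup>2 * (real (card J) / n)" .
  have "sum (pmf (walk k)) U = sum (pmf ?\<nu>) U"
    unfolding sum_pmf_eq_1[OF finite_atLeastAtMost_int set_walk]
      sum_pmf_eq_1[OF finite_atLeastAtMost_int set_pmf_log_coset] ..
  then have "2 * (sum (pmf (walk k)) ?T - sum (pmf ?\<nu>) ?T)
      \<le> (\<Sum>c\<in>U. \<bar>pmf (walk k) c - pmf ?\<nu> c\<bar>)"
    by (intro sum_abs_diff_ge T) simp_all
  then have "sum (pmf (walk k)) ?T - sum (pmf ?\<nu>) ?T \<le> tv_dist (lie_bracket_pmf p A B (2 * k)) (limit k)"
    unfolding tv_dist_limit by (simp only: pos_le_divide_eq zero_less_numeral mult.commute)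
  then show ?thesis by (rule order.trans[OF diff_mono[OF 1 2]])
qed

end

text \<open>
  For fixed \<open>u\<close> the two differences of logarithms determine \<open>v\<close> and \<open>w\<close>.
\<close>

lemma card_bad_triples:
  assumes "\<And>x y x' y'. [x = x'] (mod int n) \<Longrightarrow> [y = y'] (mod int n) \<Longrightarrow> R x y \<longleftrightarrow> R x' y'"
  shows "card {(u, v, w) \<in> U \<times> U \<times> U. R (lg v - lg u) (lg w - lg u)}
    \<le> card {(x, y) \<in> Zn n \<times> Zn n. R x y} * n"
proof -
  let ?S = "{(u, v, w) \<in> U \<times> U \<times> U. R (lg v - lg u) (lg w - lg u)}"
  let ?R = "{(x, y) \<in> Zn n \<times> Zn n. R x y}"
  have n: "n > 0" using p_ge_3 by simp
  have finR: "finite ?R" by (rule finite_subset[of _ "Zn n \<times> Zn n"]) auto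
  have "card ?S \<le> card ?R * card U"
  proof (rule card_le_fibers[where f = fst])
    fix u assume "u \<in> U"
    let ?F = "{s \<in> ?S. fst s = u}"
    let ?g = "\<lambda>(u :: int, v, w). ((lg v - lg u) mod int n, (lg w - lg u) mod int n)"
    have lg_eq: "v = v'" if "v \<in> U" "v' \<in> U" "(lg v - lg u) mod int n = (lg v' - lg u) mod int n" for v v'
    proof -
      have "[lg v - lg u + lg u = lg v' - lg u + lg u] (mod int n)"
        by (rule cong_add) (use that in \<open>simp_all add: cong_def\<close>)
      moreover have "lg v \<in> Zn n" "lg v' \<in> Zn n" using lg_bij that by (auto simp: bij_betw_def)
      ultimately have "lg v = lg v'" by (simp add: cong_def)
      then show ?thesis using lg_bij that by (auto simp: bij_betw_def inj_on_def)
    qed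
    have inj: "inj_on ?g ?F"
    proof
      fix s s' assume s: "s \<in> ?F" "s' \<in> ?F" "?g s = ?g s'"
      obtain v w v' w' where "s = (u, v, w)" "s' = (u, v', w')" using s by auto
      then show "s = s'" using s lg_eq[of v v'] lg_eq[of w w'] by auto
    qed
    have "?g ` ?F \<subseteq> ?R"
    proof
      fix q assume "q \<in> ?g ` ?F"
      then obtain v w where q: "q = ((lg v - lg u) mod int n, (lg w - lg u) mod int n)"
        and "R (lg v - lg u) (lg w - lg u)" by auto
      then have "R ((lg v - lg u) mod int n) ((lg w - lg u) mod int n)"
        using assms[of "lg v - lg u" "(lg v - lg u) mod int n" "lg w - lg u" "(lg w - lg u) mod int n"]
        by (simp add: cong_def)
      then show "q \<in> ?R" using n by (simp add: q)
    qed
    then have "card ?F \<le> card ?R" by (rule card_inj_on_le[OF inj _ finR])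
    moreover have "finite ?F" by (rule finite_subset[of _ "U \<times> U \<times> U"]) auto
    ultimately show "finite ?F \<and> card ?F \<le> card ?R" by simp
  qed auto
  then show ?thesis using p_ge_3 by (simp add: nat_diff_distrib)
qed

end

section \<open>Most pairs of matrices are good\<close>

lemma pair_pmf_of_set:
  assumes "finite X" "X \<noteq> {}" "finite Y" "Y \<noteq> {}"
  shows "pair_pmf (pmf_of_set X) (pmf_of_set Y) = pmf_of_set (X \<times> Y)"
  by (rule pmf_eqI, clarify)
    (use assms in \<open>simp add: pmf_pair pmf_of_set card_cartesian_product indicator_def\<close>)

context discrete_log
begin

text \<open>
  The radius \<open>r\<close> is the scale at which the two lower-bound errors balance: its square has to be a small
  multiple of \<open>p\<close>, so that \<open>9 r\<^sup>2\<close> points are few compared with the coset, and a large multiple of the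
  time \<open>c p\<close>, so that the walk has not left the region. The \<open>18\<close> is \<open>2 * 9\<close>, where the \<open>2\<close> comes from
  \<open>p \<le> 2 n\<close>.
\<close>

lemma good_pair_mixing:
  fixes \<epsilon> c t r :: real
  assumes "P \<in> vec3 p" "Q \<in> vec3 p" "(P, Q) \<notin> degenerate" "\<epsilon> > 0"
    and tail: "fourier_tail n t (lg (form p P P) - lg (form p P Q)) (lg (form p Q Q) - lg (form p P Q)) < \<epsilon>\<^sup>2"
    and peaks: "card (peaks n (lg (form p P P) - lg (form p P Q)) (lg (form p Q Q) - lg (form p P Q))) \<le> D"
    and r: "r \<ge> 1" and count: "18 * r\<^sup>2 * D \<le> \<epsilon> * p / 4" and time: "2 * c * p \<le> \<epsilon> * r\<^sup>2"
  shows "\<exists>\<nu> :: nat \<Rightarrow> mat2 pmf.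
           (\<forall>k. limiting_dist p lg (mat_of p P) (mat_of p Q) k (\<nu> k)) \<and>
           (\<forall>k. uniform_on_coset p (bracket p (mat_of p P) (mat_of p Q)) (\<nu> k)) \<and>
           (\<forall>k. real k < c * real p \<longrightarrow>
              tv_dist (lie_bracket_pmf p (mat_of p P) (mat_of p Q) (2 * k)) (\<nu> k) > 1 - \<epsilon>) \<and>
           (\<forall>k. real k > t \<longrightarrow>
              tv_dist (lie_bracket_pmf p (mat_of p P) (mat_of p Q) (2 * k)) (\<nu> k) < \<epsilon>)"
proof (intro exI conjI allI impI)
  note PQ = assms(1-3)
  let ?\<nu> = "\<lambda>k. line_coset_pmf (bracket p (mat_of p P) (mat_of p Q))
    (peaks n (lg (form p P P) - lg (form p P Q)) (lg (form p Q Q) - lg (form p P Q)))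
    (int k * lg (form p P Q))"
  show "limiting_dist p lg (mat_of p P) (mat_of p Q) k (?\<nu> k)" for k
    by (rule limiting_dist_limit[OF PQ])
  show "uniform_on_coset p (bracket p (mat_of p P) (mat_of p Q)) (?\<nu> k)" for k
    by (rule uniform_on_coset_limit[OF PQ])
  let ?d = "\<lambda>k. tv_dist (lie_bracket_pmf p (mat_of p P) (mat_of p Q) (2 * k)) (?\<nu> k)"
  show "?d k > 1 - \<epsilon>" if k: "real k < c * real p" for k
  proof -
    let ?J = "peaks n (lg (form p P P) - lg (form p P Q)) (lg (form p Q Q) - lg (form p P Q))"
    have r2: "r\<^sup>2 > 0" using r by simp
    have late: "3 * real k / (8 * r\<^sup>2) \<le> \<epsilon> * 3 / 16"
    proof -
      have "2 * real k \<le> \<epsilon> * r\<^sup>2" using k time by linarith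
      then show ?thesis using r2 by (simp add: field_simps)
    qed
    have small: "9 * r\<^sup>2 * (real (card ?J) / n) \<le> \<epsilon> / 4"
    proof -
      have n: "real n > 0" "2 * real n \<ge> real p" using p_ge_3 by auto
      have "9 * r\<^sup>2 * (real (card ?J) / n) \<le> 9 * r\<^sup>2 * (real D / n)"
        using peaks by (intro mult_left_mono divide_right_mono) auto
      also have "\<dots> = 18 * r\<^sup>2 * D / (2 * real n)" by (simp add: field_simps)
      also have "\<dots> \<le> (\<epsilon> * p / 4) / (2 * real n)" using count n by (intro divide_right_mono) auto
      also have "\<dots> \<le> (\<epsilon> * (2 * real n) / 4) / (2 * real n)"
        using n assms(4) by (intro divide_right_mono mult_left_mono) auto
      also have "\<dots> = \<epsilon> / 4" using n by (simp del: of_nat_diff)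
      finally show ?thesis .
    qed
    have combine: "1 - \<epsilon> < d" if "u \<le> \<epsilon> * 3 / 16" "v \<le> \<epsilon> / 4" "1 - u - v \<le> d" for u v d :: real
      using that assms(4) by linarith
    show ?thesis by (rule combine[OF late small tv_dist_limit_lower[OF PQ r]])
  qed
  show "?d k < \<epsilon>" if k: "real k > t" for k
  proof -
    have "(2 * ?d k)\<^sup>2 < \<epsilon>\<^sup>2"
      by (rule le_less_trans[OF tv_dist_limit_upper[OF PQ less_imp_le[OF k]] tail])
    then have "2 * ?d k < \<epsilon>" by (rule power_less_imp_less_base) (rule less_imp_le[OF assms(4)])
    moreover have "u < \<epsilon>" if "2 * u < \<epsilon>" for u using that assms(4) by linarith
    ultimately show ?thesis by blast
  qed
qed

text \<open>
  Of the three summands, the first counts degenerate pairs, the second pairs for which the coset is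
  short, and the third pairs with slow Fourier decay.
\<close>

lemma card_bad_pairs:
  fixes t \<eta> :: real
  assumes "D \<ge> 1" "t > 0" "\<eta> > 0"
  defines "x \<equiv> \<lambda>P Q. lg (form p P P) - lg (form p P Q)" and "y \<equiv> \<lambda>P Q. lg (form p Q Q) - lg (form p P Q)"
  shows "card {(P, Q) \<in> vec3 p \<times> vec3 p. (P, Q) \<in> degenerate \<or> card (peaks n (x P Q) (y P Q)) > D
      \<or> fourier_tail n t (x P Q) (y P Q) \<ge> \<eta>}
    \<le> 7 * real p ^ 5 + 4 * real p ^ 6 / D + 48 * real p ^ 7 / (t * \<eta>)"
proof -
  have n: "n > 0" and np: "real n \<le> real p" using p_ge_3 by auto
  define T1 where "T1 = {(u, v, w) \<in> U \<times> U \<times> U. card (peaks n (lg v - lg u) (lg w - lg u)) > D}"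
  define T2 where "T2 = {(u, v, w) \<in> U \<times> U \<times> U. fourier_tail n t (lg v - lg u) (lg w - lg u) \<ge> \<eta>}"
  let ?E = "\<lambda>T. {(P, Q) \<in> vec3 p \<times> vec3 p. fst (snd P) \<noteq> 0 \<and> (form p P Q, form p P P, form p Q Q) \<in> T}"
  have T1: "real (card T1) \<le> real p ^ 3 / D"
  proof -
    have "card T1 \<le> card {(x, y) \<in> Zn n \<times> Zn n. card (peaks n x y) > D} * n"
      unfolding T1_def by (rule card_bad_triples) (drule (1) peaks_cong[OF n], simp only:)
    then have "real (card T1) \<le> real (card {(x, y) \<in> Zn n \<times> Zn n. card (peaks n x y) > D}) * real n"
      by (simp only: of_nat_le_iff flip: of_nat_mult)
    also have "\<dots> \<le> real n ^ 2 / D * real n"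
      by (intro mult_right_mono card_many_peaks n assms) simp
    also have "\<dots> = real n ^ 3 / D" by (simp only: power3_eq_cube power2_eq_square times_divide_eq_left)
    also have "\<dots> \<le> real p ^ 3 / D" using np by (intro divide_right_mono power_mono) auto
    finally show ?thesis .
  qed
  have T2: "real (card T2) \<le> 12 * real p ^ 4 / (t * \<eta>)"
  proof -
    have "card T2 \<le> card {(x, y) \<in> Zn n \<times> Zn n. fourier_tail n t x y \<ge> \<eta>} * n"
      unfolding T2_def by (rule card_bad_triples) (drule (1) fourier_tail_cong[OF n, where t = t], simp only:)
    then have "real (card T2) \<le> real (card {(x, y) \<in> Zn n \<times> Zn n. fourier_tail n t x y \<ge> \<eta>}) * real n"
      by (simp only: of_nat_le_iff flip: of_nat_mult)
    also have "\<dots> \<le> 12 * real n ^ 3 / (t * \<eta>) * real n"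
      by (intro mult_right_mono card_large_fourier_tail n assms) simp
    also have "\<dots> = 12 * real n ^ 4 / (t * \<eta>)"
    proof -
      have "12 * m ^ 3 / s * m = 12 * m ^ 4 / s" for m s :: real
        by (simp add: power3_eq_cube power4_eq_xxxx)
      then show ?thesis .
    qed
    also have "\<dots> \<le> 12 * real p ^ 4 / (t * \<eta>)"
      using np assms(2,3) by (intro divide_right_mono mult_left_mono power_mono) auto
    finally show ?thesis .
  qed
  have E: "real (card (?E T)) \<le> 4 * real p ^ 3 * real (card T)" if "T \<subseteq> U \<times> U \<times> U" for T
  proof -
    have "T \<subseteq> Zn p \<times> Zn p \<times> Zn p" using that by (rule order.trans) (intro Sigma_mono; auto)
    from of_nat_mono[OF card_pairs_with_forms[OF this], where 'a = real] show ?thesis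
      by (simp only: of_nat_mult of_nat_power of_nat_numeral)
  qed
  have sub: "{(P, Q) \<in> vec3 p \<times> vec3 p. (P, Q) \<in> degenerate \<or> card (peaks n (x P Q) (y P Q)) > D
      \<or> fourier_tail n t (x P Q) (y P Q) \<ge> \<eta>} \<subseteq> degenerate \<union> ?E T1 \<union> ?E T2"
  proof
    fix s assume s: "s \<in> {(P, Q) \<in> vec3 p \<times> vec3 p. (P, Q) \<in> degenerate \<or> card (peaks n (x P Q) (y P Q)) > D
      \<or> fourier_tail n t (x P Q) (y P Q) \<ge> \<eta>}"
    obtain P Q where PQ: "s = (P, Q)" by (cases s)
    have v: "P \<in> vec3 p" "Q \<in> vec3 p" using s unfolding PQ by blast+
    show "s \<in> degenerate \<union> ?E T1 \<union> ?E T2"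
    proof (cases "(P, Q) \<in> degenerate")
      case False
      have U: "form p P Q \<in> U" "form p P P \<in> U" "form p Q Q \<in> U"
        using forms_in_U[OF v False] .
      have "fst (snd P) \<noteq> 0" using False v by (auto simp: degenerate_def)
      moreover have "(form p P Q, form p P P, form p Q Q) \<in> T1 \<union> T2"
        using s False U unfolding PQ T1_def T2_def x_def y_def by blast
      ultimately show ?thesis using v unfolding PQ by blast
    qed (simp add: PQ)
  qed
  have "finite (degenerate \<union> ?E T1 \<union> ?E T2)"
    by (rule finite_subset[of _ "vec3 p \<times> vec3 p"]) (auto simp: degenerate_def)
  then have "card {(P, Q) \<in> vec3 p \<times> vec3 p. (P, Q) \<in> degenerate \<or> card (peaks n (x P Q) (y P Q)) > D
      \<or> fourier_tail n t (x P Q) (y P Q) \<ge> \<eta>} \<le> card (degenerate \<union> ?E T1 \<union> ?E T2)"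
    by (rule card_mono[OF _ sub])
  also have "\<dots> \<le> card degenerate + card (?E T1) + card (?E T2)"
    using card_Un_le[of "degenerate \<union> ?E T1" "?E T2"] card_Un_le[of degenerate "?E T1"] by linarith
  finally have union: "real (card {(P, Q) \<in> vec3 p \<times> vec3 p. (P, Q) \<in> degenerate
      \<or> card (peaks n (x P Q) (y P Q)) > D \<or> fourier_tail n t (x P Q) (y P Q) \<ge> \<eta>})
    \<le> real (card degenerate) + real (card (?E T1)) + real (card (?E T2))"
    by (simp only: of_nat_le_iff flip: of_nat_add)
  have deg: "real (card degenerate) \<le> 7 * real p ^ 5"
    using of_nat_mono[OF card_degenerate, where 'a = real]
    by (simp only: of_nat_mult of_nat_power of_nat_numeral)
  have E1: "real (card (?E T1)) \<le> 4 * real p ^ 3 * (real p ^ 3 / D)"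
  proof (rule order.trans[OF E])
    show "T1 \<subseteq> U \<times> U \<times> U" unfolding T1_def by blast
  qed (intro mult_left_mono T1, simp)
  have E2: "real (card (?E T2)) \<le> 4 * real p ^ 3 * (12 * real p ^ 4 / (t * \<eta>))"
  proof (rule order.trans[OF E])
    show "T2 \<subseteq> U \<times> U \<times> U" unfolding T2_def by blast
  qed (intro mult_left_mono T2, simp)
  have arith: "4 * q ^ 3 * (q ^ 3 / s) = 4 * q ^ 6 / s" "4 * q ^ 3 * (12 * q ^ 4 / s) = 48 * q ^ 7 / s" for q s :: real
    by (simp_all add: eval_nat_numeral)
  from order.trans[OF union add_mono[OF add_mono[OF deg E1] E2]] show ?thesis
    by (simp only: arith)
qed

lemma prob_sl2_pairs:
  "measure_pmf.prob (pair_pmf (pmf_of_set (sl2 p)) (pmf_of_set (sl2 p))) G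
    = card {(P, Q) \<in> vec3 p \<times> vec3 p. (mat_of p P, mat_of p Q) \<in> G} / real p ^ 6"
proof -
  have vec: "finite (vec3 p)" "vec3 p \<noteq> {}" using p_pos by auto
  have sl2: "pmf_of_set (sl2 p) = map_pmf (mat_of p) (pmf_of_set (vec3 p))"
    using map_pmf_of_set_inj[of "mat_of p" "vec3 p"] bij_mat_of[OF p_pos] vec
    by (simp add: bij_betw_def)
  have "pair_pmf (pmf_of_set (sl2 p)) (pmf_of_set (sl2 p))
      = map_pmf (\<lambda>(P, Q). (mat_of p P, mat_of p Q)) (pmf_of_set (vec3 p \<times> vec3 p))"
    by (simp only: sl2 map_pair[symmetric] pair_pmf_of_set[OF vec vec])
  then have "measure_pmf.prob (pair_pmf (pmf_of_set (sl2 p)) (pmf_of_set (sl2 p))) G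
     = measure_pmf.prob (pmf_of_set (vec3 p \<times> vec3 p)) ((\<lambda>(P, Q). (mat_of p P, mat_of p Q)) -` G)"
    by simp
  also have "\<dots> = card ((vec3 p \<times> vec3 p) \<inter> (\<lambda>(P, Q). (mat_of p P, mat_of p Q)) -` G) / card (vec3 p \<times> vec3 p)"
    by (rule measure_pmf_of_set) (use vec in auto)
  also have "(vec3 p \<times> vec3 p) \<inter> (\<lambda>(P, Q). (mat_of p P, mat_of p Q)) -` G
    = {(P, Q) \<in> vec3 p \<times> vec3 p. (mat_of p P, mat_of p Q) \<in> G}" by auto
  also have "real (card (vec3 p \<times> vec3 p)) = real p ^ 6"
    by (simp add: card_cartesian_product power_numeral_reduce)
  finally show ?thesis .
qed

lemma prob_sl2_pairs_ge:
  assumes "\<And>P Q. P \<in> vec3 p \<Longrightarrow> Q \<in> vec3 p \<Longrightarrow> \<not> Bad P Q \<Longrightarrow> (mat_of p P, mat_of p Q) \<in> G"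
    and "card {(P, Q) \<in> vec3 p \<times> vec3 p. Bad P Q} \<le> \<delta> * real p ^ 6"
  shows "measure_pmf.prob (pair_pmf (pmf_of_set (sl2 p)) (pmf_of_set (sl2 p))) G \<ge> 1 - \<delta>"
proof -
  let ?b = "{(P, Q) \<in> vec3 p \<times> vec3 p. Bad P Q}"
  let ?g = "{(P, Q) \<in> vec3 p \<times> vec3 p. (mat_of p P, mat_of p Q) \<in> G}"
  have fin: "finite (?b \<union> ?g)" by (rule finite_subset[of _ "vec3 p \<times> vec3 p"]) auto
  have "card (vec3 p \<times> vec3 p) \<le> card (?b \<union> ?g)"
    by (rule card_mono[OF fin]) (use assms(1) in blast)
  also have "\<dots> \<le> card ?b + card ?g" by (rule card_Un_le)
  finally have "real (card (vec3 p \<times> vec3 p)) \<le> real (card ?b) + real (card ?g)"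
    by (simp only: of_nat_le_iff flip: of_nat_add)
  moreover have "real (card (vec3 p \<times> vec3 p)) = real p ^ 6"
    by (simp add: card_cartesian_product power_numeral_reduce)
  ultimately have "(1 - \<delta>) * real p ^ 6 \<le> real (card ?g)"
    using assms(2) by (simp add: left_diff_distrib)
  then show ?thesis unfolding prob_sl2_pairs using p_pos by (simp add: pos_le_divide_eq)
qed

end

theorem theorem1p1:
  fixes \<delta> \<epsilon> :: real
  assumes "\<delta> > 0" and "\<epsilon> > 0"
  shows "\<exists>C c :: real. C > 0 \<and> c > 0 \<and>
    (\<forall>(p :: nat) lg. prime p \<and> odd p \<and> real p > C \<and>
        lg \<in> iso (Fp_mult p) (integer_mod_group (p - 1)) \<longrightarrow>
      measure_pmf.prob (pair_pmf (pmf_of_set (sl2 p)) (pmf_of_set (sl2 p)))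
        {(A, B). \<exists>\<nu> :: nat \<Rightarrow> mat2 pmf.
           (\<forall>k. limiting_dist p lg A B k (\<nu> k)) \<and>
           (\<forall>k. uniform_on_coset p (bracket p A B) (\<nu> k)) \<and>
           (\<forall>k. real k < c * real p \<longrightarrow>
              tv_dist (lie_bracket_pmf p A B (2 * k)) (\<nu> k) > 1 - \<epsilon>) \<and>
           (\<forall>k. real k > C * real p \<longrightarrow>
              tv_dist (lie_bracket_pmf p A B (2 * k)) (\<nu> k) < \<epsilon>)}
        \<ge> 1 - \<delta>)"
proof -
  \<comment> \<open>Each of the three kinds of bad pairs gets probability at most \<open>\<delta>/3\<close>: \<open>D\<close> settles short cosets, and
    the first and third bound on \<open>C\<close> settle degenerate pairs and slow decay. The second one makes \<open>r \<ge> 1\<close>.\<close>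
  define D where "D = max 1 (nat \<lceil>12 / \<delta>\<rceil>)"
  have D: "D \<ge> 1" "real D \<ge> 12 / \<delta>" by (auto simp: D_def max_def) linarith+
  define \<rho> where "\<rho> = \<epsilon> / (72 * D)"
  have \<rho>: "\<rho> > 0" "18 * \<rho> * D = \<epsilon> / 4" using D(1) assms by (auto simp: \<rho>_def)
  define C where "C = Max {21 / \<delta>, 1 / \<rho>, 144 / (\<delta> * \<epsilon>\<^sup>2)}"
  have C: "C \<ge> 21 / \<delta>" "C \<ge> 1 / \<rho>" "C \<ge> 144 / (\<delta> * \<epsilon>\<^sup>2)" by (simp_all add: C_def)
  have C0: "C > 0" using C(2) \<rho>(1) by (smt (verit) divide_pos_pos)
  define c where "c = \<epsilon> * \<rho> / 2"
  have c0: "c > 0" using assms \<rho> by (simp add: c_def)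
  show ?thesis
  proof (rule exI[of _ C], rule exI[of _ c], intro conjI allI impI C0 c0)
    fix p lg
    assume asm: "prime p \<and> odd p \<and> real p > C \<and> lg \<in> iso (Fp_mult p) (integer_mod_group (p - 1))"
    interpret discrete_log p lg by unfold_locales (use asm in auto)
    have p: "real p > 0" using p_pos by simp
    define r where "r = sqrt (\<rho> * p)"
    have "1 / \<rho> \<le> real p" using C(2) asm by linarith
    then have rp: "\<rho> * p \<ge> 1" using \<rho>(1) by (simp add: field_simps)
    then have r: "r \<ge> 1" "r\<^sup>2 = \<rho> * p" by (simp_all add: r_def)
    define x where "x = (\<lambda>P Q. lg (form p P P) - lg (form p P Q))"
    define y where "y = (\<lambda>P Q. lg (form p Q Q) - lg (form p P Q))"
    let ?Bad = "\<lambda>P Q. (P, Q) \<in> degenerate \<or> card (peaks n (x P Q) (y P Q)) > D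
      \<or> fourier_tail n (C * p) (x P Q) (y P Q) \<ge> \<epsilon>\<^sup>2"
    show "measure_pmf.prob (pair_pmf (pmf_of_set (sl2 p)) (pmf_of_set (sl2 p)))
        {(A, B). \<exists>\<nu> :: nat \<Rightarrow> mat2 pmf.
           (\<forall>k. limiting_dist p lg A B k (\<nu> k)) \<and>
           (\<forall>k. uniform_on_coset p (bracket p A B) (\<nu> k)) \<and>
           (\<forall>k. real k < c * real p \<longrightarrow>
              tv_dist (lie_bracket_pmf p A B (2 * k)) (\<nu> k) > 1 - \<epsilon>) \<and>
           (\<forall>k. real k > C * real p \<longrightarrow>
              tv_dist (lie_bracket_pmf p A B (2 * k)) (\<nu> k) < \<epsilon>)}
        \<ge> 1 - \<delta>"
    proof (rule prob_sl2_pairs_ge[where Bad = ?Bad])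
      fix P Q assume PQ: "P \<in> vec3 p" "Q \<in> vec3 p" and good: "\<not> ?Bad P Q"
      have "18 * r\<^sup>2 * D \<le> \<epsilon> * p / 4"
      proof -
        have "18 * r\<^sup>2 * D = (18 * \<rho> * D) * p" by (simp add: r)
        then show ?thesis by (simp add: \<rho>(2))
      qed
      moreover have "2 * c * p \<le> \<epsilon> * r\<^sup>2" by (simp add: r c_def)
      ultimately show "(mat_of p P, mat_of p Q) \<in> {(A, B). \<exists>\<nu> :: nat \<Rightarrow> mat2 pmf.
           (\<forall>k. limiting_dist p lg A B k (\<nu> k)) \<and>
           (\<forall>k. uniform_on_coset p (bracket p A B) (\<nu> k)) \<and>
           (\<forall>k. real k < c * real p \<longrightarrow>
              tv_dist (lie_bracket_pmf p A B (2 * k)) (\<nu> k) > 1 - \<epsilon>) \<and>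
           (\<forall>k. real k > C * real p \<longrightarrow>
              tv_dist (lie_bracket_pmf p A B (2 * k)) (\<nu> k) < \<epsilon>)}"
        using good unfolding mem_Collect_eq case_prod_conv
        by (intro good_pair_mixing[OF PQ _ assms(2) _ _ r(1)]) (auto simp: x_def y_def)
    next
      have bad: "real (card {(P, Q) \<in> vec3 p \<times> vec3 p. ?Bad P Q})
        \<le> 7 * real p ^ 5 + 4 * real p ^ 6 / D + 48 * real p ^ 7 / (C * p * \<epsilon>\<^sup>2)"
        unfolding x_def y_def
        by (rule card_bad_pairs[OF D(1)]) (use C0 p assms in auto)
      have t1: "7 * real p ^ 5 \<le> \<delta> / 3 * real p ^ 6"
      proof -
        have "21 / \<delta> \<le> p" using C(1) asm by linarith
        then have "7 \<le> \<delta> / 3 * p" using assms by (simp add: field_simps)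
        then have "7 * real p ^ 5 \<le> \<delta> / 3 * p * real p ^ 5" by (rule mult_right_mono) simp
        then show ?thesis by (simp add: power_numeral_reduce mult_ac)
      qed
      have t2: "4 * real p ^ 6 / D \<le> \<delta> / 3 * real p ^ 6"
      proof -
        have "4 / D \<le> \<delta> / 3" using D assms by (simp add: field_simps)
        then show ?thesis using mult_right_mono[of "4 / D" "\<delta> / 3" "real p ^ 6"] by simp
      qed
      have t3: "48 * real p ^ 7 / (C * p * \<epsilon>\<^sup>2) \<le> \<delta> / 3 * real p ^ 6"
      proof -
        have "48 / (C * \<epsilon>\<^sup>2) \<le> \<delta> / 3" using C(3) C0 assms by (simp add: field_simps)
        then have "48 / (C * \<epsilon>\<^sup>2) * real p ^ 6 \<le> \<delta> / 3 * real p ^ 6" by (rule mult_right_mono) simp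
        moreover have "48 * real p ^ 7 / (C * p * \<epsilon>\<^sup>2) = 48 / (C * \<epsilon>\<^sup>2) * real p ^ 6"
          using p by (simp add: power_numeral_reduce)
        ultimately show ?thesis by simp
      qed
      have "\<delta> / 3 * q + \<delta> / 3 * q + \<delta> / 3 * q = \<delta> * q" for q by simp
      with order.trans[OF bad add_mono[OF add_mono[OF t1 t2] t3]]
      show "real (card {(P, Q) \<in> vec3 p \<times> vec3 p. ?Bad P Q}) \<le> \<delta> * real p ^ 6"
        by (simp only:)
    qed
  qed
qed

end
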